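(* Let $\mathcal{L}=(i_1,\ldots,i_k)$ be a signature with $i_k\ge 1$ and let $S\subseteq\mathbb{N}$. Let $\mathbf{X}=(X_t,t\ge 0)$ be a continuous time combinatorial Lévy process on $\mathcal{L}_S$. Then there is a unique measure $\mu$ on $\mathcal{L}_S$ satisfying $$\mu(\{\mathbf{0}_S^{\mathcal{L}}\})=0\quad\text{and}\quad \mu(\{M^*\in\mathcal{L}_S: M^*|_{S\cap[n]}\neq \mathbf{0}^{\mathcal{L}}_{S\cap[n]}\})<\infty\ \text{ for all } n\in\mathbb{N},$$ such that the infinitesimal jump rates of $\mathbf{X}$ satisfy $$\lim_{t\downarrow 0}\frac1t\,\mathbb{P}\{X_t\in d\Delta\}=\mu(d\Delta),\qquad \Delta\in\mathcal{L}_S\setminus\{\mathbf{0}_S^{\mathcal{L}}\},$$ where the convergence is understood in the sense of vague convergence of $\sigma$-finite measures (on $\mathcal{L}_S\setminus\{\mathbf{0}_S^{\mathcal{L}}\}$).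
   Context: A signature is a finite list $\mathcal{L}=(i_1,\ldots,i_k)$ of integers $0\le i_1\le\cdots\le i_k$. For $S\subseteq\mathbb{N}=\{1,2,\ldots\}$, an $\mathcal{L}$-structure over $S$ is $M=(S;M_1,\ldots,M_k)$ with $M_j\subseteq S^{i_j}$ for each $j$ (with $S^0:=\{\odot\}$ a one-point set); $\mathcal{L}_S$ is the set of these. $\mathbf{0}_S^{\mathcal{L}}=(S;\emptyset,\ldots,\emptyset)$. The increment $M\triangle M'\in\mathcal{L}_S$ of $M,M'\in\mathcal{L}_S$ is the componentwise symmetric difference. For $S'\subseteq S$, $M|_{S'}=(S';M_1\cap S'^{i_1},\ldots,M_k\cap S'^{i_k})$; $[n]=\{1,\ldots,n\}$. If $S$ is finite, $\mathcal{L}_S$ has the discrete topology; if $S$ is infinite, it has the product discrete topology (convergence means eventual agreement of the restrictions to $S\cap[n]$ for each $n$; for $S=\mathbb{N}$ it is induced by $d(M,M')=1/(1+\sup\{n: M|_{[n]}=M'|_{[n]}\})$). $\mathcal{L}_S$ carries its Borel $\sigma$-field. A continuous time combinatorial Lévy process on $\mathcal{L}_S$ is a process $(X_t)_{t\ge0}$ with values in $\mathcal{L}_S$ such that $X_0=\mathbf{0}_S^{\mathcal{L}}$; $X_{t+s}\triangle X_s=_{\mathcal D}X_t$ (equality in distribution) for all $s,t\ge 0$; $X_{t_1}\triangle X_{t_0},\ldots,X_{t_r}\triangle X_{t_{r-1}}$ are independent for all $0\le t_0\le\cdots\le t_r<\infty$; and $t\mapsto X_t$ is càdlàg (right continuous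 with left limits) for the topology on $\mathcal{L}_S$ that is discrete if $S$ is finite and product discrete if $S$ is infinite. *)

theory Defs
  imports "HOL-Probability.Probability"
begin

text \<open>A signature is a sorted \<open>nat list\<close> \<open>L\<close>; list positions run from 0, so \<open>L ! j\<close> is
  \<open>i\<^sub>j\<^sub>+\<^sub>1\<close>. A structure \<open>(S; M\<^sub>1, \<dots>, M\<^sub>k)\<close> is represented by the list of its relations, the base set
  \<open>S\<close> being a parameter of every notion below. Tuples are lists, so \<open>tuples S 0 = {[]}\<close> is the
  one-point set \<open>S\<^sup>0\<close>, also for empty \<open>S\<close>.\<close>

type_synonym rels = "nat list set list"

definition tuples :: "nat set \<Rightarrow> nat \<Rightarrow> nat list set" where
  "tuples S i = {xs. length xs = i \<and> set xs \<subseteq> S}"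

definition structs :: "nat list \<Rightarrow> nat set \<Rightarrow> rels set" where
  "structs L S = {M. length M = length L \<and> (\<forall>j < length L. M ! j \<subseteq> tuples S (L ! j))}"

text \<open>The relations of \<open>\<zero>\<^sub>S\<close> do not depend on \<open>S\<close>.\<close>

definition zero_struct :: "nat list \<Rightarrow> rels" where
  "zero_struct L = replicate (length L) {}"

definition increment :: "rels \<Rightarrow> rels \<Rightarrow> rels" where
  "increment M M' = map2 sym_diff M M'"

definition restr :: "nat list \<Rightarrow> nat set \<Rightarrow> rels \<Rightarrow> rels" where
  "restr L S' M = map2 (\<lambda>i R. R \<inter> tuples S' i) L M"

text \<open>For infinite \<open>S\<close>, the product discrete topology is the one induced from the product of the
  discrete spaces of structures over \<open>S \<inter> [n]\<close> by \<open>M \<mapsto> (M|\<^bsub>S \<inter> [n]\<^esub>)\<^sub>n\<close>. The factor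
  \<open>n = 0\<close> is determined by the others.\<close>

definition struct_topology :: "nat list \<Rightarrow> nat set \<Rightarrow> rels topology" where
  "struct_topology L S =
     (if finite S then discrete_topology (structs L S)
      else pullback_topology (structs L S) (\<lambda>M n. restr L (S \<inter> {1..n}) M)
             (product_topology (\<lambda>n. discrete_topology (structs L (S \<inter> {1..n}))) UNIV))"

definition struct_borel :: "nat list \<Rightarrow> nat set \<Rightarrow> rels measure" where
  "struct_borel L S = sigma (structs L S) {U. openin (struct_topology L S) U}"

definition cadlag :: "'a topology \<Rightarrow> (real \<Rightarrow> 'a) \<Rightarrow> bool" where
  "cadlag T x \<longleftrightarrow>
     (\<forall>t\<ge>0. limitin T x (x t) (at_right t)) \<and> (\<forall>t>0. \<exists>l. limitin T x l (at_left t))"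

text \<open>Only the values \<open>X t\<close> with \<open>t \<ge> 0\<close> matter. The properties of paths are required almost surely.\<close>

locale comb_levy_process = prob_space P
  for P :: "'w measure" and L :: "nat list" and S :: "nat set" and X :: "real \<Rightarrow> 'w \<Rightarrow> rels" +
  assumes random: "\<And>t. 0 \<le> t \<Longrightarrow> random_variable (struct_borel L S) (X t)"
    and start: "AE \<omega> in P. X 0 \<omega> = zero_struct L"
    and stationary: "\<And>s t. 0 \<le> s \<Longrightarrow> 0 \<le> t \<Longrightarrow>
      distr P (struct_borel L S) (\<lambda>\<omega>. increment (X (t + s) \<omega>) (X s \<omega>)) =
      distr P (struct_borel L S) (X t)"
    and independent: "\<And>(r::nat) \<tau>. 0 \<le> \<tau> 0 \<Longrightarrow> (\<And>i. i < r \<Longrightarrow> \<tau> i \<le> \<tau> (Suc i)) \<Longrightarrow>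
      indep_vars (\<lambda>_. struct_borel L S)
        (\<lambda>i \<omega>. increment (X (\<tau> (Suc i)) \<omega>) (X (\<tau> i) \<omega>)) {..<r}"
    and paths: "AE \<omega> in P. cadlag (struct_topology L S) (\<lambda>t. X t \<omega>)"

text \<open>Vague convergence is meant for measures finite on compact sets, where all the
  integrals below exist.\<close>

definition compact_support :: "'a topology \<Rightarrow> ('a \<Rightarrow> real) \<Rightarrow> bool" where
  "compact_support T f \<longleftrightarrow> compactin T (T closure_of {x \<in> topspace T. f x \<noteq> 0})"

definition vague_convergence ::
    "'a topology \<Rightarrow> ('b \<Rightarrow> 'a measure) \<Rightarrow> 'a measure \<Rightarrow> 'b filter \<Rightarrow> bool" where
  "vague_convergence T N \<mu> F \<longleftrightarrow>
     (\<forall>f. continuous_map T euclideanreal f \<and> compact_support T f \<longrightarrow>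
        ((\<lambda>t. integral\<^sup>L (N t) f) \<longlongrightarrow> integral\<^sup>L \<mu> f) F)"

end

theory Submission
  imports Defs
begin

text \<open>
  Identify a structure with the set of its facts, the pairs of a relation index and a tuple in that
  relation. The increment becomes symmetric difference, so structures over a finite window form a
  finite group of exponent 2, whose characters are the products of signs
  \<open>\<chi>\<^sub>A(M) = (-1)\<^bsup>|A \<inter> facts M|\<^esup>\<close>. Independence and stationarity of the increments
  make \<open>t \<mapsto> E \<chi>\<^sub>A(X\<^sub>t)\<close> multiplicative, and right continuity of the paths at 0 gives it the
  limit 1 at 0. Hence it is an exponential \<open>exp (- c t)\<close> and has a right derivative at 0
  (\<open>bounded_multiplicative_right_deriv\<close>). The event that the restriction of \<open>X\<^sub>t\<close> to a window is a
  given structure has an indicator that is a linear combination of characters, so for a nonzero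
  structure its probability divided by \<open>t\<close> converges as \<open>t\<close> decreases to 0
  (\<open>view_rate_exists\<close>).

  Call a set of structures a cylinder if membership depends only on the restriction to some window
  and the zero structure is not in it. Summing over finitely many restrictions, \<open>P(X\<^sub>t \<in> B) / t\<close> has
  a limit for every cylinder \<open>B\<close>. The limit is a finite additive function on the ring of
  cylinders. Cylinders are compact, so a decreasing sequence of them with empty intersection is
  eventually empty, and Caratheodory's theorem extends the limit to a measure \<open>\<mu>\<close>
  (\<open>rate_measure_exists\<close>).

  A continuous function with compact support off the zero structure vanishes outside a cylinder and
  is uniformly close to a function of the restriction to a large window
  (\<open>test_function_uniform\<close>), so convergence on cylinders implies vague convergence
  (\<open>vague_convergence_from_cylinders\<close>). Conversely, the indicators of cylinders are test functions.
  So the vague limit determines a measure on the cylinders, and therefore everywhere except at the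
  zero structure, which has mass zero.
\<close>

section \<open>Structures as sets of facts\<close>

definition view :: "nat list \<Rightarrow> nat set \<Rightarrow> nat \<Rightarrow> rels \<Rightarrow> rels" where
  "view L S n M = restr L (S \<inter> {1..n}) M"

definition positions :: "nat list \<Rightarrow> nat set \<Rightarrow> (nat \<times> nat list) set" where
  "positions L S = {(j, xs). j < length L \<and> xs \<in> tuples S (L ! j)}"

definition facts :: "rels \<Rightarrow> (nat \<times> nat list) set" where
  "facts M = {(j, xs). j < length M \<and> xs \<in> M ! j}"

definition of_facts :: "nat list \<Rightarrow> (nat \<times> nat list) set \<Rightarrow> rels" where
  "of_facts L F = map (\<lambda>j. {xs. (j, xs) \<in> F}) [0..<length L]"

lemma tuples_mono: "S \<subseteq> S' \<Longrightarrow> tuples S i \<subseteq> tuples S' i"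
  by (auto simp: tuples_def)

lemma finite_tuples: "finite S \<Longrightarrow> finite (tuples S i)"
  unfolding tuples_def using finite_lists_length_eq[of S i] by (simp add: conj_commute)

lemma positions_mono: "S \<subseteq> S' \<Longrightarrow> positions L S \<subseteq> positions L S'"
  using tuples_mono[of S S'] by (auto simp: positions_def)

lemma finite_positions: "finite S \<Longrightarrow> finite (positions L S)"
proof -
  assume "finite S"
  then have "finite (Sigma {..<length L} (\<lambda>j. tuples S (L ! j)))"
    by (auto intro: finite_tuples)
  moreover have "positions L S = Sigma {..<length L} (\<lambda>j. tuples S (L ! j))"
    by (auto simp: positions_def)
  ultimately show ?thesis by simp
qed

text \<open>A tuple has finitely many entries, so it lies in some window \<open>S \<inter> [n]\<close>. This is why
  restrictions to windows separate structures and why sets defined by one fact are open.\<close>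

lemma positions_in_window: "S \<subseteq> {1..} \<Longrightarrow> c \<in> positions L S \<Longrightarrow> \<exists>n. c \<in> positions L (S \<inter> {1..n})"
proof -
  assume S: "S \<subseteq> {1..}" and c: "c \<in> positions L S"
  have "set (snd c) \<subseteq> {1..Max (insert 0 (set (snd c)))}"
    using S c by (fastforce simp: positions_def tuples_def)
  then show ?thesis using c
    by (intro exI[of _ "Max (insert 0 (set (snd c)))"])
      (auto simp: positions_def tuples_def)
qed

lemma structs_length: "M \<in> structs L S \<Longrightarrow> length M = length L"
  by (simp add: structs_def)

lemma structs_mono: "S \<subseteq> S' \<Longrightarrow> structs L S \<subseteq> structs L S'"
  using tuples_mono[of S S'] by (auto simp: structs_def) blast

lemma facts_inject: "length M = length M' \<Longrightarrow> facts M = facts M' \<Longrightarrow> M = M'"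
  by (rule nth_equalityI) (auto simp: facts_def set_eq_iff)

lemma facts_subset: "M \<in> structs L S \<Longrightarrow> facts M \<subseteq> positions L S"
  by (auto simp: structs_def facts_def positions_def)

lemma of_facts_in_structs: "F \<subseteq> positions L S \<Longrightarrow> of_facts L F \<in> structs L S"
  by (auto simp: structs_def of_facts_def positions_def)

lemma facts_of_facts: "F \<subseteq> positions L S \<Longrightarrow> facts (of_facts L F) = F"
  by (auto simp: facts_def of_facts_def positions_def)

lemma facts_zero [simp]: "facts (zero_struct L) = {}"
  by (auto simp: facts_def zero_struct_def)

lemma length_zero [simp]: "length (zero_struct L) = length L"
  by (simp add: zero_struct_def)

lemma facts_restr: "length M = length L \<Longrightarrow> facts (restr L S M) = facts M \<inter> positions L S"
  by (auto simp: facts_def restr_def positions_def)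

lemma length_restr [simp]: "length M = length L \<Longrightarrow> length (restr L S M) = length L"
  by (simp add: restr_def)

lemma facts_increment: "length M = length M' \<Longrightarrow> facts (increment M M') = sym_diff (facts M) (facts M')"
  by (auto simp: facts_def increment_def)

lemma zero_in_structs [simp]: "zero_struct L \<in> structs L S"
  by (simp add: structs_def zero_struct_def)

lemma restr_in_structs: "length M = length L \<Longrightarrow> restr L S M \<in> structs L S"
  by (auto simp: structs_def restr_def)

lemma restr_eq_iff:
  "length M = length L \<Longrightarrow> length M' = length L \<Longrightarrow>
    restr L S M = restr L S M' \<longleftrightarrow> facts M \<inter> positions L S = facts M' \<inter> positions L S"
  by (metis facts_inject facts_restr length_restr)

lemma restr_zero [simp]: "restr L S (zero_struct L) = zero_struct L"
  by (rule facts_inject) (simp_all add: facts_restr)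

lemma restr_id: "M \<in> structs L S \<Longrightarrow> restr L S M = M"
  using facts_subset[of M L S]
  by (intro facts_inject) (auto simp add: facts_restr structs_length)

lemma restr_eq_mono:
  assumes "S' \<subseteq> S" "length M = length L" "length M' = length L" "restr L S M = restr L S M'"
  shows "restr L S' M = restr L S' M'"
  using assms positions_mono[OF assms(1)] by (simp add: restr_eq_iff) blast

lemma view_mono:
  "m \<le> n \<Longrightarrow> M \<in> structs L S \<Longrightarrow> M' \<in> structs L S \<Longrightarrow> view L S n M = view L S n M' \<Longrightarrow>
    view L S m M = view L S m M'"
  unfolding view_def by (rule restr_eq_mono[of _ "S \<inter> {1..n}"]) (auto simp: structs_length)

lemma view_in_structs: "M \<in> structs L S \<Longrightarrow> view L S n M \<in> structs L (S \<inter> {1..n})"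
  by (simp add: view_def restr_in_structs structs_length)

lemma view_eq_iff:
  "M \<in> structs L S \<Longrightarrow> M' \<in> structs L S \<Longrightarrow> view L S n M = view L S n M' \<longleftrightarrow>
    facts M \<inter> positions L (S \<inter> {1..n}) = facts M' \<inter> positions L (S \<inter> {1..n})"
  by (simp only: view_def restr_eq_iff structs_length)

lemma views_eqI:
  assumes "S \<subseteq> {1..}" "M \<in> structs L S" "M' \<in> structs L S" "\<And>n. view L S n M = view L S n M'"
  shows "M = M'"
proof (rule facts_inject)
  show "facts M = facts M'"
  proof (rule set_eqI)
    fix c
    show "c \<in> facts M \<longleftrightarrow> c \<in> facts M'"
    proof (cases "c \<in> positions L S")
      case True
      then obtain n where "c \<in> positions L (S \<inter> {1..n})"
        using positions_in_window assms(1) by blast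
      then show ?thesis using assms(4)[of n] assms(2,3)
        by (auto simp: view_def restr_eq_iff structs_length)
    next
      case False
      then show ?thesis using assms(2,3) facts_subset by blast
    qed
  qed
qed (use assms in \<open>simp add: structs_length\<close>)

lemma finite_structs: "finite S \<Longrightarrow> finite (structs L S)"
proof -
  assume "finite S"
  then have "finite (facts ` structs L S)"
    by (rule finite_subset[rotated, OF finite_Pow_iff[THEN iffD2, OF finite_positions]])
      (use facts_subset in blast)
  moreover have "inj_on facts (structs L S)"
    by (auto intro!: inj_onI facts_inject simp: structs_length)
  ultimately show ?thesis by (rule finite_imageD)
qed

section \<open>The topology in terms of finite windows\<close>

lemma topspace_struct [simp]: "topspace (struct_topology L S) = structs L S"
proof (cases "finite S")
  case False
  then show ?thesis
    using view_in_structs[unfolded view_def]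
    by (auto simp: struct_topology_def topspace_pullback_topology simp del: One_nat_def)
qed (simp add: struct_topology_def)

text \<open>Restrictions are consistent, so the finitely many coordinates that a basic open set of the product
  constrains are all determined by the largest one. If \<open>S\<close> is finite, a window
  containing all of \<open>S\<close> makes the condition trivial, as it must be in the discrete topology. This
  criterion is what the rest of the development uses, for finite and infinite \<open>S\<close> alike.\<close>

lemma openin_struct_topology:
  assumes "S \<subseteq> {1..}"
  shows "openin (struct_topology L S) U \<longleftrightarrow> U \<subseteq> structs L S \<and>
    (\<forall>M\<in>U. \<exists>n. \<forall>M'\<in>structs L S. view L S n M' = view L S n M \<longrightarrow> M' \<in> U)"
proof (cases "finite S")
  case True
  have eq: "M' = M" if "M \<in> structs L S" "M' \<in> structs L S" "view L S (Max (insert 0 S)) M' = view L S (Max (insert 0 S)) M" for M M'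
  proof -
    have "S \<inter> {1..Max (insert 0 S)} = S"
    proof (rule Int_absorb2, rule subsetI)
      fix x assume "x \<in> S"
      then show "x \<in> {1..Max (insert 0 S)}"
        using True assms Max_ge[of "insert 0 S" x] by (auto simp del: Max_insert Max.insert)
    qed
    then show ?thesis using that(3) unfolding view_def by (simp only: restr_id that)
  qed
  have "openin (struct_topology L S) U \<longleftrightarrow> U \<subseteq> structs L S"
    using True by (simp add: struct_topology_def)
  moreover have "\<exists>n. \<forall>M'\<in>structs L S. view L S n M' = view L S n M \<longrightarrow> M' \<in> U"
    if "U \<subseteq> structs L S" "M \<in> U" for M
  proof (intro exI ballI impI)
    fix M' assume "M' \<in> structs L S" "view L S (Max (insert 0 S)) M' = view L S (Max (insert 0 S)) M"
    then have "M' = M" using that eq by blast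
    then show "M' \<in> U" using that by simp
  qed
  ultimately show ?thesis by blast
next
  case False
  let ?f = "\<lambda>M n. view L S n M"
  let ?D = "\<lambda>n. discrete_topology (structs L (S \<inter> {1..n}))"
  let ?T = "product_topology ?D UNIV"
  have T: "struct_topology L S = pullback_topology (structs L S) ?f ?T"
    using False by (simp add: struct_topology_def view_def)
  show ?thesis
  proof safe
    assume U: "openin (struct_topology L S) U"
    then show "M \<in> structs L S" if "M \<in> U" for M using that openin_subset by fastforce
    fix M assume M: "M \<in> U"
    obtain V where V: "openin ?T V" "U = ?f -` V \<inter> structs L S"
      using U unfolding T openin_pullback_topology by auto
    then obtain W where W: "finite {i. W i \<noteq> topspace (?D i)}"
      "?f M \<in> PiE UNIV W" "PiE UNIV W \<subseteq> V"
    proof -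
      have "?f M \<in> V" using M V(2) by blast
      with V(1) have "\<exists>W. finite {i \<in> UNIV. W i \<noteq> topspace (?D i)} \<and>
          (\<forall>i\<in>UNIV. openin (?D i) (W i)) \<and> ?f M \<in> PiE UNIV W \<and> PiE UNIV W \<subseteq> V"
        unfolding openin_product_topology_alt by (rule bspec)
      then obtain W where "finite {i \<in> UNIV. W i \<noteq> topspace (?D i)}"
        and W: "?f M \<in> PiE UNIV W" "PiE UNIV W \<subseteq> V" by (elim exE conjE) (rule that)
      from this(1) have "finite {i. W i \<noteq> topspace (?D i)}" by simp
      from this W show thesis by (rule that)
    qed
    let ?n = "Max (insert 0 {i. W i \<noteq> topspace (?D i)})"
    show "\<exists>n. \<forall>M'\<in>structs L S. view L S n M' = view L S n M \<longrightarrow> M' \<in> U"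
    proof (intro exI ballI impI)
      fix M' assume M': "M' \<in> structs L S" "view L S ?n M' = view L S ?n M"
      have "?f M' i \<in> W i" for i
      proof (cases "W i = topspace (?D i)")
        case True
        then show ?thesis using view_in_structs[OF M'(1)] by (simp only: topspace_discrete_topology)
      next
        case False
        then have "i \<le> ?n" using W(1) by (intro Max_ge) auto
        then have "view L S i M' = view L S i M"
          using M' M V(2) by (intro view_mono[of i ?n]) auto
        then show ?thesis using W(2) by (simp add: PiE_iff)
      qed
      then show "M' \<in> U" using W(3) V(2) M' by auto
    qed
  next
    assume U: "U \<subseteq> structs L S"
      and loc: "\<forall>M\<in>U. \<exists>n. \<forall>M'\<in>structs L S. view L S n M' = view L S n M \<longrightarrow> M' \<in> U"
    then obtain n where n: "\<And>M M'. M \<in> U \<Longrightarrow> M' \<in> structs L S \<Longrightarrow>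
      view L S (n M) M' = view L S (n M) M \<Longrightarrow> M' \<in> U" by metis
    let ?B = "\<lambda>M. {x \<in> topspace ?T. x (n M) \<in> {view L S (n M) M}}"
    have "openin ?T (?B M)" if "M \<in> U" for M
      by (rule openin_continuous_map_preimage[OF continuous_map_product_projection[of "n M"]])
        (use that U in \<open>auto intro!: view_in_structs[unfolded One_nat_def]\<close>)
    then have "openin ?T (\<Union>M\<in>U. ?B M)" by blast
    moreover have "U = ?f -` (\<Union>M\<in>U. ?B M) \<inter> structs L S"
    proof (intro equalityI subsetI)
      fix M assume M: "M \<in> U"
      then have "?f M \<in> ?B M" using U by (auto intro!: view_in_structs[unfolded One_nat_def])
      then show "M \<in> ?f -` (\<Union>M\<in>U. ?B M) \<inter> structs L S" using M U by blast
    qed (use n in blast)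
    ultimately show "openin (struct_topology L S) U"
      unfolding T openin_pullback_topology by blast
  qed
qed

text \<open>Every set of positions is the set of facts of exactly one structure, so the structures are a
  continuous image of the Cantor cube of 0-1 labellings of the positions, which is compact by
  Tychonoff.\<close>

lemma compact_space_struct_topology:
  assumes "S \<subseteq> {1..}"
  shows "compact_space (struct_topology L S)"
proof -
  let ?C = "product_topology (\<lambda>_. discrete_topology (UNIV :: bool set)) (positions L S)"
  let ?g = "\<lambda>x. of_facts L {c \<in> positions L S. x c}"
  have facts_g: "facts (?g x) = {c \<in> positions L S. x c}" for x
    by (rule facts_of_facts) auto
  have g: "?g x \<in> structs L S" for x
    by (rule of_facts_in_structs) auto
  have "continuous_map ?C (struct_topology L S) ?g"
    unfolding continuous_map
  proof (intro conjI allI impI)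
    show "?g ` topspace ?C \<subseteq> topspace (struct_topology L S)" using g by auto
    fix U assume U: "openin (struct_topology L S) U"
    show "openin ?C {x \<in> topspace ?C. ?g x \<in> U}"
    proof (subst openin_subopen, intro ballI)
      fix x assume x: "x \<in> {x \<in> topspace ?C. ?g x \<in> U}"
      then obtain n where n: "\<And>M'. M' \<in> structs L S \<Longrightarrow> view L S n M' = view L S n (?g x) \<Longrightarrow> M' \<in> U"
        using U unfolding openin_struct_topology[OF assms] by blast
      let ?P = "positions L (S \<inter> {1..n})"
      let ?V = "topspace ?C \<inter> (\<Inter>c\<in>?P. {y \<in> topspace ?C. y c \<in> {x c}})"
      have sub: "?P \<subseteq> positions L S" by (rule positions_mono) auto
      have "openin ?C ({y \<in> topspace ?C. y c \<in> {x c}})" if "c \<in> ?P" for c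
        by (rule openin_continuous_map_preimage[OF continuous_map_product_projection])
          (use sub that in auto)
      then have "openin ?C ?V"
        using openin_topspace[of ?C] finite_positions[of "S \<inter> {1..n}" L]
        by (cases "?P = {}") (simp, intro openin_Int openin_Inter, auto)
      moreover have "x \<in> ?V" using x by auto
      moreover have "?V \<subseteq> {x \<in> topspace ?C. ?g x \<in> U}"
      proof safe
        fix y assume "y \<in> topspace ?C" "y \<in> (\<Inter>c\<in>?P. {y \<in> topspace ?C. y c \<in> {x c}})"
        then have "facts (?g y) \<inter> ?P = facts (?g x) \<inter> ?P"
          unfolding facts_g using sub by auto
        then show "?g y \<in> U" by (intro n g) (simp only: view_eq_iff[OF g g])
      qed
      ultimately show "\<exists>V. openin ?C V \<and> x \<in> V \<and> V \<subseteq> {x \<in> topspace ?C. ?g x \<in> U}" by blast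
    qed
  qed
  moreover have "compactin ?C (topspace ?C)"
    using compact_space_product_topology[of "\<lambda>_. discrete_topology (UNIV :: bool set)" "positions L S"]
    unfolding compact_space_def[symmetric] by (simp add: compact_space_discrete_topology)
  ultimately have "compactin (struct_topology L S) (?g ` topspace ?C)"
    by (rule image_compactin[rotated])
  moreover have "?g ` topspace ?C = structs L S"
  proof
    show "structs L S \<subseteq> ?g ` topspace ?C"
    proof
      fix M assume M: "M \<in> structs L S"
      let ?x = "restrict (\<lambda>c. c \<in> facts M) (positions L S)"
      have "facts (?g ?x) = facts M"
        unfolding facts_g using facts_subset[OF M] by auto
      then have "?g ?x = M"
        by (rule facts_inject[rotated]) (simp only: structs_length[OF g] structs_length[OF M])
      then show "M \<in> ?g ` topspace ?C" by (intro image_eqI[OF sym]) auto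
    qed
  qed (use g in auto)
  ultimately show ?thesis by (simp add: compact_space_def)
qed

section \<open>Multiplicative functions and characters\<close>

text \<open>Repeated halving brings any argument close to 0, where the function is positive, so it is positive
  everywhere. Minus its logarithm is then additive and, by the bound, nonnegative, hence monotone
  and therefore linear. The function is an exponential.\<close>

lemma bounded_multiplicative_right_deriv:
  fixes \<phi> :: "real \<Rightarrow> real"
  assumes mult: "\<And>s t. 0 \<le> s \<Longrightarrow> 0 \<le> t \<Longrightarrow> \<phi> (s + t) = \<phi> s * \<phi> t"
    and bound: "\<And>t. 0 \<le> t \<Longrightarrow> \<bar>\<phi> t\<bar> \<le> 1"
    and lim: "(\<phi> \<longlongrightarrow> 1) (at_right 0)"
  shows "\<exists>l. ((\<lambda>t. (\<phi> t - 1) / t) \<longlongrightarrow> l) (at_right 0)"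
proof -
  have power: "\<phi> (real (Suc n) * t) = \<phi> t ^ Suc n" if "0 \<le> t" for n t
  proof (induction n)
    case (Suc n)
    have "\<phi> (real (Suc (Suc n)) * t) = \<phi> (t + real (Suc n) * t)"
      by (simp add: algebra_simps)
    also have "\<dots> = \<phi> t * \<phi> (real (Suc n) * t)"
      using that by (intro mult) auto
    finally show ?case using Suc by simp
  qed simp
  have "\<forall>\<^sub>F t in at_right 0. 0 < \<phi> t"
    using lim by (rule order_tendstoD) simp
  then obtain d where d: "0 < d" "\<And>t. 0 < t \<Longrightarrow> t < d \<Longrightarrow> 0 < \<phi> t"
    by (auto simp: eventually_at_right_field)
  have pos: "0 < \<phi> t" if "0 < t" for t
  proof -
    obtain n where "t < real n * d" using d(1) reals_Archimedean3 by blast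
    moreover have "real n * d \<le> real (Suc n) * d" using d(1) by simp
    ultimately have "0 < \<phi> (t / real (Suc n))"
      using that by (intro d(2)) (auto simp: field_simps)
    then have "0 < \<phi> (t / real (Suc n)) ^ Suc n" by (rule zero_less_power)
    also have "\<dots> = \<phi> (real (Suc n) * (t / real (Suc n)))"
      using that by (intro power[symmetric]) auto
    finally show ?thesis by (simp del: of_nat_Suc)
  qed
  define g where "g t = - ln (\<phi> t)" for t
  have g_add: "g (s + t) = g s + g t" if "0 < s" "0 < t" for s t
    using that pos[of s] pos[of t] by (simp add: g_def mult ln_mult)
  have g_nonneg: "0 \<le> g t" if "0 < t" for t
    using that bound[of t] pos[of t] by (simp add: g_def)
  have g_mono: "g s \<le> g t" if "0 < s" "s \<le> t" for s t
    using that g_add[of s "t - s"] g_nonneg[of "t - s"] by (cases "s = t") auto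
  have g_nat: "g (real n * t) = real n * g t" if "0 < n" "0 < t" for n t
    using that power[of t "n - 1"] pos[of t] by (simp add: g_def ln_realpow)
  \<comment> \<open>Squeeze \<open>n t\<close> between consecutive integers: \<open>n g(t)\<close> and \<open>n t g(1)\<close> differ by at most \<open>g(1)\<close> for all \<open>n\<close>.\<close>
  have g_linear: "g t = t * g 1" if "0 < t" for t
  proof -
    have "\<bar>g t - t * g 1\<bar> = 0"
    proof (rule real_archimedian_rdiv_eq_0)
      fix n :: nat assume "0 < n"
      define m where "m = nat \<lfloor>real n * t\<rfloor>"
      have m: "real m \<le> real n * t" "real n * t < real m + 1"
        using that unfolding m_def by (auto simp: floor_correct)
      have lower: "real m * g 1 \<le> real n * g t"
      proof (cases "m = 0")
        case True
        then show ?thesis using g_nonneg[OF that] by simp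
      next
        case False
        then have "real m * g 1 = g (real m * 1)" by (intro g_nat[symmetric]) auto
        also have "\<dots> \<le> g (real n * t)" using m(1) False by (intro g_mono) auto
        finally show ?thesis using \<open>0 < n\<close> that by (simp add: g_nat)
      qed
      have "real n * g t = g (real n * t)" using \<open>0 < n\<close> that by (simp add: g_nat)
      also have "\<dots> \<le> g (real (Suc m) * 1)" using m(2) \<open>0 < n\<close> that by (intro g_mono) auto
      also have "\<dots> = real (Suc m) * g 1" by (intro g_nat) auto
      finally have upper: "real n * g t \<le> (real m + 1) * g 1" by (simp add: algebra_simps)
      have "real m * g 1 \<le> real n * t * g 1" "real n * t * g 1 \<le> (real m + 1) * g 1"
        using m g_nonneg[of 1] by (auto intro!: mult_right_mono)
      then have "\<bar>real n * (g t - t * g 1)\<bar> \<le> g 1"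
        using lower upper by (simp add: algebra_simps abs_le_iff)
      then show "real n * \<bar>g t - t * g 1\<bar> \<le> g 1" by (simp add: abs_mult)
    qed (use g_nonneg[of 1] in auto)
    then show ?thesis by simp
  qed
  have exp: "\<phi> t = exp (- g 1 * t)" if "0 < t" for t
    using g_linear[OF that] pos[OF that] unfolding g_def by (metis exp_ln minus_minus mult.commute mult_minus_right)
  have "((\<lambda>t. exp (- g 1 * t)) has_real_derivative - g 1) (at 0)"
    by (auto intro!: derivative_eq_intros)
  then have "((\<lambda>t. (exp (- g 1 * t) - 1) / t) \<longlongrightarrow> - g 1) (at_right 0)"
    by (auto simp: has_field_derivative_iff intro: filterlim_mono[OF _ order_refl at_le])
  moreover have "\<forall>\<^sub>F t in at_right 0. (exp (- g 1 * t) - 1) / t = (\<phi> t - 1) / t"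
    using eventually_at_right_less[of 0] by eventually_elim (simp add: exp)
  ultimately show ?thesis by (blast intro: Lim_transform_eventually)
qed

text \<open>The characters of the group of structures under the increment.\<close>

definition character :: "(nat \<times> nat list) set \<Rightarrow> rels \<Rightarrow> real" where
  "character A M = (\<Prod>c\<in>A. if c \<in> facts M then - 1 else 1)"

lemma abs_character [simp]: "\<bar>character A M\<bar> = 1"
  unfolding character_def by (induction A rule: infinite_finite_induct) (auto simp: abs_mult)

lemma character_zero [simp]: "character A (zero_struct L) = 1"
  by (simp add: character_def)

lemma character_increment:
  assumes "length M = length M'"
  shows "character A M = character A (increment M M') * character A M'"
  unfolding character_def prod.distrib[symmetric]
  by (rule prod.cong) (auto simp: facts_increment[OF assms])

text \<open>Fourier inversion on a finite group of exponent 2, obtained by expanding a product: the factor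
  \<open>(1 \<plusminus> \<chi>\<^sub>c) / 2\<close>, where \<open>\<chi>\<^sub>c\<close> is the sign of the position \<open>c\<close>, is the indicator of the
  event that \<open>c\<close> has the status prescribed by \<open>E\<close>.\<close>

lemma indicator_eq_sum_characters:
  assumes "finite F" "E \<subseteq> F"
  shows "\<exists>a. \<forall>M. of_bool (facts M \<inter> F = E) = (\<Sum>A\<in>Pow F. a A * character A M)"
proof -
  define e :: "_ \<Rightarrow> real" where "e c = (if c \<in> E then - 1 else 1)" for c
  define a where "a A = (\<Prod>c\<in>A. e c / 2) * (\<Prod>c\<in>F - A. 1 / 2)" for A
  show ?thesis
  proof (intro exI allI)
    fix M
    have factor: "e c / 2 * (if c \<in> facts M then - 1 else 1) + 1 / 2 = of_bool (c \<in> facts M \<longleftrightarrow> c \<in> E)" for c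
      by (auto simp: e_def)
    have "of_bool (facts M \<inter> F = E) = (\<Prod>c\<in>F. of_bool (c \<in> facts M \<longleftrightarrow> c \<in> E) :: real)"
    proof (cases "facts M \<inter> F = E")
      case False
      then have "\<exists>c\<in>F. \<not> (c \<in> facts M \<longleftrightarrow> c \<in> E)" using assms(2) by blast
      then show ?thesis using False assms(1) by simp
    qed (auto intro!: prod.neutral)
    also have "\<dots> = (\<Prod>c\<in>F. e c / 2 * (if c \<in> facts M then - 1 else 1) + 1 / 2)"
      by (simp only: factor)
    also have "\<dots> = (\<Sum>A\<in>Pow F. (\<Prod>c\<in>A. e c / 2 * (if c \<in> facts M then - 1 else 1)) * (\<Prod>c\<in>F - A. 1 / 2))"
      by (rule prod_add[OF assms(1)])
    also have "\<dots> = (\<Sum>A\<in>Pow F. a A * character A M)"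
      by (simp only: a_def character_def prod.distrib mult_ac)
    finally show "of_bool (facts M \<inter> F = E) = (\<Sum>A\<in>Pow F. a A * character A M)" .
  qed
qed

section \<open>Small-time rates of restrictions\<close>

lemma space_struct_borel [simp]: "space (struct_borel L S) = structs L S"
  by (simp add: struct_borel_def space_measure_of_conv)

lemma openin_subset_structs: "{U. openin (struct_topology L S) U} \<subseteq> Pow (structs L S)"
  using openin_subset by fastforce

lemma sets_struct_borel: "sets (struct_borel L S) = sigma_sets (structs L S) {U. openin (struct_topology L S) U}"
  using openin_subset_structs by (simp add: struct_borel_def)

lemma open_in_sets_struct_borel: "openin (struct_topology L S) U \<Longrightarrow> U \<in> sets (struct_borel L S)"
  by (simp add: sets_struct_borel)

lemma openin_fact:
  assumes "S \<subseteq> {1..}"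
  shows "openin (struct_topology L S) {M \<in> structs L S. c \<in> facts M}"
    and "openin (struct_topology L S) {M \<in> structs L S. c \<notin> facts M}"
proof -
  show "openin (struct_topology L S) {M \<in> structs L S. c \<in> facts M}"
    unfolding openin_struct_topology[OF assms]
  proof (intro conjI ballI)
    fix M assume M: "M \<in> {M \<in> structs L S. c \<in> facts M}"
    then obtain n where "c \<in> positions L (S \<inter> {1..n})"
      using positions_in_window[OF assms] facts_subset by blast
    then show "\<exists>n. \<forall>M'\<in>structs L S. view L S n M' = view L S n M \<longrightarrow> M' \<in> {M \<in> structs L S. c \<in> facts M}"
      using M by (intro exI[of _ n]) (auto simp only: view_eq_iff)
  qed auto
  show "openin (struct_topology L S) {M \<in> structs L S. c \<notin> facts M}"
  proof (cases "c \<in> positions L S")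
    case True
    then obtain n where "c \<in> positions L (S \<inter> {1..n})"
      using positions_in_window[OF assms] by blast
    then show ?thesis
      unfolding openin_struct_topology[OF assms]
      by (intro conjI ballI exI[of _ n]) (auto simp only: view_eq_iff)
  next
    case False
    then have "{M \<in> structs L S. c \<notin> facts M} = topspace (struct_topology L S)"
      using facts_subset by auto
    then show ?thesis by (simp only: openin_topspace)
  qed
qed

lemma character_measurable:
  assumes "S \<subseteq> {1..}"
  shows "character A \<in> borel_measurable (struct_borel L S)"
  unfolding character_def
proof (intro borel_measurable_prod measurable_If)
  show "{x \<in> space (struct_borel L S). c \<in> facts x} \<in> sets (struct_borel L S)" for c
    using openin_fact(1)[OF assms] by (simp add: open_in_sets_struct_borel)
qed auto

context comb_levy_process
begin

lemma value_in_structs: "0 \<le> t \<Longrightarrow> \<omega> \<in> space P \<Longrightarrow> X t \<omega> \<in> structs L S"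
  using measurable_space[OF random] by simp

lemma length_value: "0 \<le> t \<Longrightarrow> \<omega> \<in> space P \<Longrightarrow> length (X t \<omega>) = length L"
  using value_in_structs structs_length by blast

lemma character_integrable:
  assumes "S \<subseteq> {1..}" "0 \<le> t"
  shows "integrable P (\<lambda>\<omega>. character A (X t \<omega>))"
  using measurable_compose[OF random[OF assms(2)] character_measurable[OF assms(1)]]
  by (intro integrable_const_bound[of _ 1]) auto

text \<open>Since \<open>X\<^sub>0 = \<zero>\<close> almost surely, \<open>X\<^bsub>s+t\<^esub>\<close> is the sum in the group of the independent increments over
  \<open>[0, s]\<close> and \<open>[s, s + t]\<close>, and a character turns the sum into a product.\<close>

lemma expectation_character_add:
  assumes "S \<subseteq> {1..}" "0 \<le> s" "0 \<le> t"
  shows "expectation (\<lambda>\<omega>. character A (X (s + t) \<omega>)) =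
    expectation (\<lambda>\<omega>. character A (X s \<omega>)) * expectation (\<lambda>\<omega>. character A (X t \<omega>))"
proof -
  \<comment> \<open>Only \<open>\<tau> 0\<close>, \<open>\<tau> 1\<close>, \<open>\<tau> 2\<close> matter: they give the two increments.\<close>
  define \<tau> where "\<tau> i = (if i = 0 then 0 else if i = 1 then s else s + t)" for i :: nat
  let ?D = "\<lambda>i \<omega>. increment (X (\<tau> (Suc i)) \<omega>) (X (\<tau> i) \<omega>)"
  note char[measurable] = character_measurable[OF assms(1), of A]
  have "indep_vars (\<lambda>_. struct_borel L S) ?D {..<2}"
    using assms by (intro independent) (auto simp: \<tau>_def)
  then have indep: "indep_vars (\<lambda>_. borel) (\<lambda>i \<omega>. character A (?D i \<omega>)) {..<2}"
    by (rule indep_vars_compose2) (rule char)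
  have D[measurable]: "?D 0 \<in> measurable P (struct_borel L S)" "?D 1 \<in> measurable P (struct_borel L S)"
    using \<open>indep_vars (\<lambda>_. struct_borel L S) ?D {..<2}\<close> by (auto simp: indep_vars_def)
  have [measurable]: "X s \<in> measurable P (struct_borel L S)" "X (s + t) \<in> measurable P (struct_borel L S)"
    "X t \<in> measurable P (struct_borel L S)"
    using assms by (auto intro: random)
  have "expectation (\<lambda>\<omega>. \<Prod>i<2. character A (?D i \<omega>)) = (\<Prod>i<2. expectation (\<lambda>\<omega>. character A (?D i \<omega>)))"
  proof (rule indep_vars_lebesgue_integral[OF _ indep])
    fix i :: nat assume "i \<in> {..<2}"
    then have "i = 0 \<or> i = 1" by auto
    then show "integrable P (\<lambda>\<omega>. character A (?D i \<omega>))"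
      using measurable_compose[OF D(1) char] measurable_compose[OF D(2) char]
      by (auto intro!: integrable_const_bound[of _ 1])
  qed simp
  then have prod: "expectation (\<lambda>\<omega>. character A (?D 0 \<omega>) * character A (?D 1 \<omega>)) =
      expectation (\<lambda>\<omega>. character A (?D 0 \<omega>)) * expectation (\<lambda>\<omega>. character A (?D 1 \<omega>))"
    by (simp add: numeral_2_eq_2)
  have D0: "AE \<omega> in P. character A (?D 0 \<omega>) = character A (X s \<omega>)"
    using start AE_space
  proof eventually_elim
    case (elim \<omega>)
    then show ?case
      using character_increment[of "X s \<omega>" "X 0 \<omega>" A] assms
      by (simp add: \<tau>_def length_value)
  qed
  have "expectation (\<lambda>\<omega>. character A (X (s + t) \<omega>)) =
      expectation (\<lambda>\<omega>. character A (?D 0 \<omega>) * character A (?D 1 \<omega>))"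
  proof (rule integral_cong_AE)
    show "AE \<omega> in P. character A (X (s + t) \<omega>) = character A (?D 0 \<omega>) * character A (?D 1 \<omega>)"
      using D0 AE_space
    proof eventually_elim
      case (elim \<omega>)
      then show ?case
        using character_increment[of "X (s + t) \<omega>" "X s \<omega>" A] assms
        by (simp add: \<tau>_def length_value mult.commute)
    qed
  qed measurable
  also note prod
  also have "expectation (\<lambda>\<omega>. character A (?D 0 \<omega>)) = expectation (\<lambda>\<omega>. character A (X s \<omega>))"
    by (rule integral_cong_AE[OF _ _ D0]) measurable
  also have "expectation (\<lambda>\<omega>. character A (?D 1 \<omega>)) =
      integral\<^sup>L (distr P (struct_borel L S) (?D 1)) (character A)"
    by (rule integral_distr[symmetric, OF D(2) char])
  also have "distr P (struct_borel L S) (?D 1) = distr P (struct_borel L S) (X t)"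
    using stationary[OF assms(2,3)] by (simp add: \<tau>_def add.commute)
  also have "integral\<^sup>L \<dots> (character A) = expectation (\<lambda>\<omega>. character A (X t \<omega>))"
    using assms by (intro integral_distr) (auto simp: random char)
  finally show ?thesis .
qed

text \<open>For finite \<open>A\<close> the structures without facts in \<open>A\<close> form a neighbourhood of the zero structure. A path that
  is right continuous at 0 and starts at zero stays in it for a short time, and there the character
  is 1. Dominated convergence does the rest.\<close>

lemma expectation_character_tendsto:
  assumes "S \<subseteq> {1..}" "finite A"
  shows "((\<lambda>t. expectation (\<lambda>\<omega>. character A (X t \<omega>))) \<longlongrightarrow> 1) (at_right 0)"
  unfolding tendsto_at_iff_sequentially
proof (intro allI impI)
  fix \<tau> :: "nat \<Rightarrow> real" assume \<tau>: "\<forall>i. \<tau> i \<in> {0<..} - {0}" "\<tau> \<longlonglongrightarrow> 0"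
  have "filterlim \<tau> (at_right 0) sequentially"
    using \<tau> by (auto simp: filterlim_at less_imp_neq[symmetric])
  have "(\<lambda>i. expectation (\<lambda>\<omega>. character A (X (\<tau> i) \<omega>))) \<longlonglongrightarrow> expectation (\<lambda>_. 1)"
  proof (rule integral_dominated_convergence[where w = "\<lambda>_. 1"])
    show "(\<lambda>\<omega>. character A (X (\<tau> i) \<omega>)) \<in> borel_measurable P" for i
      using \<tau>(1) by (intro borel_measurable_integrable character_integrable[OF assms(1)]) (auto intro: less_imp_le)
    show "AE \<omega> in P. (\<lambda>i. character A (X (\<tau> i) \<omega>)) \<longlonglongrightarrow> 1"
      using start paths
    proof eventually_elim
      case (elim \<omega>)
      let ?U = "topspace (struct_topology L S) \<inter> (\<Inter>c\<in>A. {M \<in> structs L S. c \<notin> facts M})"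
      have "openin (struct_topology L S) ?U"
        using openin_topspace[of "struct_topology L S"] openin_fact(2)[OF assms(1)] assms(2)
        by (cases "A = {}") (simp, intro openin_Int openin_Inter, auto)
      moreover have "limitin (struct_topology L S) (\<lambda>t. X t \<omega>) (zero_struct L) (at_right 0)"
      proof -
        have "limitin (struct_topology L S) (\<lambda>t. X t \<omega>) (X 0 \<omega>) (at_right 0)"
          using elim(2) order_refl[of "0 :: real"] unfolding cadlag_def by blast
        then show ?thesis by (simp only: elim(1))
      qed
      moreover have "zero_struct L \<in> ?U" by simp
      ultimately have "\<forall>\<^sub>F t in at_right 0. X t \<omega> \<in> ?U"
        unfolding limitin_def by blast
      then have "\<forall>\<^sub>F i in sequentially. X (\<tau> i) \<omega> \<in> ?U"
        using \<open>filterlim \<tau> (at_right 0) sequentially\<close> by (rule eventually_compose_filterlim)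
      then have "\<forall>\<^sub>F i in sequentially. character A (X (\<tau> i) \<omega>) = 1"
        by eventually_elim (auto simp: character_def intro!: prod.neutral)
      then show ?case by (rule tendsto_eventually)
    qed
  qed auto
  then show "((\<lambda>t. expectation (\<lambda>\<omega>. character A (X t \<omega>))) \<circ> \<tau>) \<longlonglongrightarrow> 1"
    by (simp add: comp_def prob_space)
qed

text \<open>A linear combination of characters that represents the indicator of a restriction to be \<open>A\<close> takes the
  value 0 at the zero structure if \<open>A\<close> is nonzero. Its coefficients therefore sum to 0, and the
  probability is a combination of the differences \<open>E \<chi>\<^sub>B(X\<^sub>t) - 1\<close>, each of which is
  differentiable from the right at 0.\<close>

lemma view_rate_exists:
  assumes "S \<subseteq> {1..}" "A \<in> structs L (S \<inter> {1..n})" "A \<noteq> zero_struct L"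
  shows "\<exists>l. ((\<lambda>t. prob {\<omega> \<in> space P. view L S n (X t \<omega>) = A} / t) \<longlongrightarrow> l) (at_right 0)"
proof -
  let ?F = "positions L (S \<inter> {1..n})"
  have fin: "finite ?F" by (rule finite_positions) simp
  have sub: "facts A \<subseteq> ?F" using assms(2) by (rule facts_subset)
  obtain a where a: "\<And>M. of_bool (facts M \<inter> ?F = facts A) = (\<Sum>B\<in>Pow ?F. a B * character B M)"
    using indicator_eq_sum_characters[OF fin sub] by blast
  have "facts A \<noteq> {}"
    using assms(2,3) facts_inject[of A "zero_struct L"] by (auto simp: structs_length)
  then have "(\<Sum>B\<in>Pow ?F. a B) = 0"
    using a[of "zero_struct L"] by simp
  let ?\<phi> = "\<lambda>B t. expectation (\<lambda>\<omega>. character B (X t \<omega>))"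
  have ex: "\<exists>l. ((\<lambda>t. (?\<phi> B t - 1) / t) \<longlongrightarrow> l) (at_right 0)" if "B \<in> Pow ?F" for B
  proof (rule bounded_multiplicative_right_deriv)
    show "?\<phi> B (s + t) = ?\<phi> B s * ?\<phi> B t" if "0 \<le> s" "0 \<le> t" for s t
      using assms(1) that by (rule expectation_character_add)
    show "\<bar>?\<phi> B t\<bar> \<le> 1" if "0 \<le> t" for t
    proof -
      have "\<bar>?\<phi> B t\<bar> \<le> expectation (\<lambda>\<omega>. \<bar>character B (X t \<omega>)\<bar>)" by (rule integral_abs_bound)
      then show ?thesis by (simp add: prob_space)
    qed
    show "(?\<phi> B \<longlongrightarrow> 1) (at_right 0)"
      using that fin by (intro expectation_character_tendsto[OF assms(1)]) (auto intro: finite_subset)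
  qed
  define l where "l B = (SOME l. ((\<lambda>t. (?\<phi> B t - 1) / t) \<longlongrightarrow> l) (at_right 0))" for B
  have l: "((\<lambda>t. (?\<phi> B t - 1) / t) \<longlongrightarrow> l B) (at_right 0)" if "B \<in> Pow ?F" for B
    unfolding l_def using ex[OF that] by (rule someI_ex)
  have "((\<lambda>t. \<Sum>B\<in>Pow ?F. a B * ((?\<phi> B t - 1) / t)) \<longlongrightarrow> (\<Sum>B\<in>Pow ?F. a B * l B)) (at_right 0)"
    by (intro tendsto_sum tendsto_mult tendsto_const l)
  moreover have "\<forall>\<^sub>F t in at_right 0. (\<Sum>B\<in>Pow ?F. a B * ((?\<phi> B t - 1) / t)) =
      prob {\<omega> \<in> space P. view L S n (X t \<omega>) = A} / t"
    using eventually_at_right_less[of 0]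
  proof eventually_elim
    case (elim t)
    have view: "view L S n M = A \<longleftrightarrow> facts M \<inter> ?F = facts A" if "M \<in> structs L S" for M
      using that assms(2) facts_inject[of "view L S n M" A]
      by (auto simp: view_def facts_restr structs_length simp del: One_nat_def)
    have ind: "indicator {\<omega> \<in> space P. view L S n (X t \<omega>) = A} \<omega> = (\<Sum>B\<in>Pow ?F. a B * character B (X t \<omega>))"
      if "\<omega> \<in> space P" for \<omega>
      using that value_in_structs[of t \<omega>] elim a[of "X t \<omega>"] by (simp add: indicator_def view)
    have int: "integrable P (\<lambda>\<omega>. character B (X t \<omega>))" for B
      using elim by (intro character_integrable[OF assms(1)]) auto
    have "prob {\<omega> \<in> space P. view L S n (X t \<omega>) = A} =
        expectation (indicator {\<omega> \<in> space P. view L S n (X t \<omega>) = A})"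
      by (simp add: Int_absorb2)
    also have "\<dots> = expectation (\<lambda>\<omega>. \<Sum>B\<in>Pow ?F. a B * character B (X t \<omega>))"
      by (rule Bochner_Integration.integral_cong) (auto simp only: ind)
    also have "\<dots> = (\<Sum>B\<in>Pow ?F. a B * ?\<phi> B t)"
      using int by (subst Bochner_Integration.integral_sum) auto
    also have "\<dots> = (\<Sum>B\<in>Pow ?F. a B * (?\<phi> B t - 1))"
      using \<open>(\<Sum>B\<in>Pow ?F. a B) = 0\<close> by (simp add: algebra_simps sum_subtractf)
    finally show ?case by (simp add: sum_divide_distrib)
  qed
  ultimately show ?thesis by (intro exI) (rule Lim_transform_eventually)
qed

end

section \<open>Cylinders away from the zero structure\<close>

definition determined :: "nat list \<Rightarrow> nat set \<Rightarrow> nat \<Rightarrow> rels set \<Rightarrow> bool" where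
  "determined L S n B \<longleftrightarrow> B \<subseteq> structs L S \<and>
    (\<forall>M\<in>B. \<forall>M'\<in>structs L S. view L S n M' = view L S n M \<longrightarrow> M' \<in> B)"

text \<open>Bounding the level below by 1 loses no cylinder and matches the windows that occur in the
  finiteness condition on the jump measure.\<close>

definition cylinders :: "nat list \<Rightarrow> nat set \<Rightarrow> rels set set" where
  "cylinders L S = {B. zero_struct L \<notin> B \<and> (\<exists>n\<ge>1. determined L S n B)}"

definition fibre :: "nat list \<Rightarrow> nat set \<Rightarrow> nat \<Rightarrow> rels \<Rightarrow> rels set" where
  "fibre L S n A = {M \<in> structs L S. view L S n M = A}"

text \<open>The structures whose restriction to the window reveals that they are not zero. These sets exhaust
  the nonzero structures, and every cylinder of level \<open>n\<close> is contained in the one of level \<open>n\<close>.\<close>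

definition visible :: "nat list \<Rightarrow> nat set \<Rightarrow> nat \<Rightarrow> rels set" where
  "visible L S n = {M \<in> structs L S. view L S n M \<noteq> zero_struct L}"

lemma determinedD: "determined L S n B \<Longrightarrow> M \<in> B \<Longrightarrow> M' \<in> structs L S \<Longrightarrow> view L S n M' = view L S n M \<Longrightarrow> M' \<in> B"
  by (simp add: determined_def)

lemma view_zero [simp]: "view L S n (zero_struct L) = zero_struct L"
  by (simp add: view_def)

lemma determined_subset: "determined L S n B \<Longrightarrow> B \<subseteq> structs L S"
  by (simp add: determined_def)

lemma determined_mono:
  assumes "m \<le> n" "determined L S m B" shows "determined L S n B"
  unfolding determined_def
proof (intro conjI ballI impI)
  fix M M' assume "M \<in> B" "M' \<in> structs L S" "view L S n M' = view L S n M"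
  then show "M' \<in> B"
    using determinedD[OF assms(2)] view_mono[OF assms(1), of M' L S M] determined_subset[OF assms(2)] by blast
qed (rule determined_subset[OF assms(2)])

lemma determined_fibre: "determined L S n (fibre L S n A)"
  by (auto simp: determined_def fibre_def)

lemma determined_visible: "determined L S n (visible L S n)"
  by (auto simp: determined_def visible_def)

lemma determined_Un: "determined L S n A \<Longrightarrow> determined L S n B \<Longrightarrow> determined L S n (A \<union> B)"
  unfolding determined_def by blast

lemma determined_Diff: "determined L S n A \<Longrightarrow> determined L S n B \<Longrightarrow> determined L S n (A - B)"
  unfolding determined_def by (intro conjI ballI impI DiffI) (blast, blast, metis DiffD1 DiffD2 subsetD)

lemma cylinders_common_level:
  assumes "A \<in> cylinders L S" "B \<in> cylinders L S"
  obtains n where "1 \<le> n" "determined L S n A" "determined L S n B"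
proof -
  obtain k m where "1 \<le> k" "determined L S k A" "1 \<le> m" "determined L S m B"
    using assms by (auto simp: cylinders_def)
  then show thesis
    using that[of "max k m"] determined_mono[of k "max k m"] determined_mono[of m "max k m"] by simp
qed

lemma ring_of_sets_cylinders: "ring_of_sets (structs L S) (cylinders L S)"
  unfolding ring_of_sets_iff
proof (intro conjI ballI)
  show "cylinders L S \<subseteq> Pow (structs L S)"
    by (auto simp: cylinders_def dest: determined_subset)
  show "{} \<in> cylinders L S"
    by (auto simp: cylinders_def determined_def)
  fix A B assume AB: "A \<in> cylinders L S" "B \<in> cylinders L S"
  then obtain n where "1 \<le> n" "determined L S n A" "determined L S n B"
    by (rule cylinders_common_level)
  with AB show "A \<union> B \<in> cylinders L S" "A - B \<in> cylinders L S"
    using determined_Un determined_Diff unfolding cylinders_def by blast+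
qed

lemma visible_in_cylinders: "1 \<le> n \<Longrightarrow> visible L S n \<in> cylinders L S"
  using determined_visible by (auto simp: cylinders_def visible_def)

lemma fibre_in_cylinders: "1 \<le> n \<Longrightarrow> A \<noteq> zero_struct L \<Longrightarrow> fibre L S n A \<in> cylinders L S"
  using determined_fibre by (auto simp: cylinders_def fibre_def)

text \<open>A structure that looks like zero at level \<open>n\<close> cannot be told apart from the zero structure by a set
  of level \<open>n\<close>.\<close>

lemma determined_subset_visible:
  assumes "determined L S n B" "zero_struct L \<notin> B" shows "B \<subseteq> visible L S n"
proof
  fix M assume M: "M \<in> B"
  have "view L S n M \<noteq> zero_struct L"
    using determinedD[OF assms(1) M, of "zero_struct L"] assms(2) by auto
  then show "M \<in> visible L S n"
    using M determined_subset[OF assms(1)] by (auto simp: visible_def)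
qed

lemma visible_mono:
  assumes "m \<le> n" shows "visible L S m \<subseteq> visible L S n"
  by (rule determined_subset_visible[OF determined_mono[OF assms determined_visible]])
    (simp add: visible_def)

context
  fixes L :: "nat list" and S :: "nat set"
  assumes S: "S \<subseteq> {1..}"
begin

lemma Union_visible: "(\<Union>n\<in>{1..}. visible L S n) = structs L S - {zero_struct L}"
proof (intro equalityI subsetI)
  fix M assume M: "M \<in> structs L S - {zero_struct L}"
  then obtain n where "view L S n M \<noteq> zero_struct L"
    using views_eqI[OF S, of M L "zero_struct L"] by auto
  then have "M \<in> visible L S n" using M by (simp add: visible_def)
  then have "M \<in> visible L S (max 1 n)" using visible_mono[of n "max 1 n"] by auto
  then show "M \<in> (\<Union>n\<in>{1..}. visible L S n)" by (intro UN_I[of "max 1 n"]) auto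
qed (auto simp: visible_def)

lemma openin_determined: "determined L S n B \<Longrightarrow> openin (struct_topology L S) B"
  unfolding openin_struct_topology[OF S] determined_def by (elim conjE, intro conjI ballI exI[of _ n]) simp_all

lemma closedin_determined:
  assumes "determined L S n B" shows "closedin (struct_topology L S) B"
proof -
  have "determined L S n (structs L S - B)"
    by (rule determined_Diff[OF _ assms]) (simp add: determined_def)
  then show ?thesis
    using openin_determined determined_subset[OF assms] by (simp add: closedin_def)
qed

lemma compactin_determined:
  assumes "determined L S n B" shows "compactin (struct_topology L S) B"
  by (rule closed_compactin[OF compact_space_struct_topology[OF S, unfolded compact_space_def]])
    (use determined_subset[OF assms] closedin_determined[OF assms] in simp_all)

lemma openin_nonzero: "openin (struct_topology L S) (structs L S - {zero_struct L})"
  unfolding Union_visible[symmetric]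
  by (rule openin_Union) (auto intro: openin_determined[OF determined_visible])

lemma locally_determined:
  assumes "openin (struct_topology L S) U" "M \<in> U"
  obtains n where "1 \<le> n" "fibre L S n (view L S n M) \<subseteq> U"
proof -
  have "\<exists>m. \<forall>M'\<in>structs L S. view L S m M' = view L S m M \<longrightarrow> M' \<in> U"
    using assms unfolding openin_struct_topology[OF S] by (elim conjE) (rule bspec)
  then obtain m where m: "\<And>M'. M' \<in> structs L S \<Longrightarrow> view L S m M' = view L S m M \<Longrightarrow> M' \<in> U"
    by blast
  have M: "M \<in> structs L S" using openin_subset[OF assms(1)] assms(2) by auto
  define n where "n = max 1 m"
  have "M' \<in> U" if "M' \<in> fibre L S n (view L S n M)" for M'
    using that M m view_mono[of m n M' L S M] by (simp add: fibre_def n_def)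
  then show thesis by (intro that[of n]) (auto simp: n_def)
qed

text \<open>An open set without the zero structure is a countable union of cylinders: the part of level \<open>n\<close>
  consists of the points whose fibre at level \<open>n\<close> stays inside. The zero structure itself is the
  complement of the union of the sets \<open>visible L S n\<close>.\<close>

lemma open_in_sigma_cylinders:
  assumes "openin (struct_topology L S) U"
  shows "U \<in> sigma_sets (structs L S) (cylinders L S)"
proof -
  interpret sigma_algebra "structs L S" "sigma_sets (structs L S) (cylinders L S)"
    using ring_of_sets_cylinders by (intro sigma_algebra_sigma_sets) (simp add: ring_of_sets_iff)
  have basic: "B \<in> sigma_sets (structs L S) (cylinders L S)" if "B \<in> cylinders L S" for B
    using that by (rule sigma_sets.Basic)
  have "structs L S - {zero_struct L} \<in> sigma_sets (structs L S) (cylinders L S)"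
    unfolding Union_visible[symmetric]
    by (intro countable_UN'' basic visible_in_cylinders) auto
  then have "structs L S - (structs L S - {zero_struct L}) \<in> sigma_sets (structs L S) (cylinders L S)"
    by (rule compl_sets)
  moreover have "structs L S - (structs L S - {zero_struct L}) = {zero_struct L}"
    using zero_in_structs by blast
  ultimately have zero: "{zero_struct L} \<in> sigma_sets (structs L S) (cylinders L S)"
    by (simp only:)
  let ?V = "U \<inter> (structs L S - {zero_struct L})"
  let ?I = "\<lambda>n. {M \<in> ?V. fibre L S n (view L S n M) \<subseteq> ?V}"
  have V: "openin (struct_topology L S) ?V"
    using assms openin_nonzero by (rule openin_Int)
  have "?V = (\<Union>n\<in>{1..}. ?I n)"
  proof (rule equalityI; rule subsetI)
    fix M assume M: "M \<in> ?V"
    then obtain n where "1 \<le> n" "fibre L S n (view L S n M) \<subseteq> ?V"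
      using locally_determined[OF V] by metis
    then show "M \<in> (\<Union>n\<in>{1..}. ?I n)" using M by (intro UN_I[of n]) simp_all
  qed blast
  moreover have "?I n \<in> cylinders L S" if "1 \<le> n" for n
  proof -
    have "determined L S n (?I n)"
      unfolding determined_def
    proof (intro conjI ballI impI)
      fix M M' assume M: "M \<in> ?I n" "M' \<in> structs L S" "view L S n M' = view L S n M"
      then have "M' \<in> fibre L S n (view L S n M)" by (simp add: fibre_def)
      then show "M' \<in> ?I n" using M by auto
    qed auto
    then show ?thesis using that by (auto simp: cylinders_def)
  qed
  then have "(\<Union>n\<in>{1..}. ?I n) \<in> sigma_sets (structs L S) (cylinders L S)"
    by (intro countable_UN'' basic) auto
  ultimately have "?V \<in> sigma_sets (structs L S) (cylinders L S)" by (simp only:)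
  moreover have "U = (if zero_struct L \<in> U then ?V \<union> {zero_struct L} else ?V)"
    using openin_subset[OF assms] by auto
  ultimately show ?thesis using Un[OF _ zero, of ?V] by (simp split: if_splits)
qed

lemma cylinders_generate: "sets (struct_borel L S) = sigma_sets (structs L S) (cylinders L S)"
  unfolding sets_struct_borel
proof (rule sigma_sets_eqI)
  show "B \<in> sigma_sets (structs L S) {U. openin (struct_topology L S) U}" if "B \<in> cylinders L S" for B
    using that openin_determined by (intro sigma_sets.Basic) (auto simp: cylinders_def)
qed (use open_in_sigma_cylinders in simp)

lemma determined_in_sets: "determined L S n B \<Longrightarrow> B \<in> sets (struct_borel L S)"
  by (intro open_in_sets_struct_borel openin_determined)

lemma cylinder_in_sets: "B \<in> cylinders L S \<Longrightarrow> B \<in> sets (struct_borel L S)"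
  by (auto simp: cylinders_def intro: determined_in_sets)

lemma nonzero_in_sets: "structs L S - {zero_struct L} \<in> sets (struct_borel L S)"
  by (intro open_in_sets_struct_borel openin_nonzero)

text \<open>Cylinders are compact and closed, so this is the finite intersection property. It is the continuity
  at the empty set that Caratheodory's theorem asks for.\<close>

lemma decseq_cylinders_empty:
  assumes "range B \<subseteq> cylinders L S" "decseq B" "(\<Inter>i. B i) = {}"
  shows "\<exists>i. B i = {}"
proof (rule ccontr)
  assume nonempty: "\<not> (\<exists>i. B i = {})"
  have det: "\<exists>n. determined L S n (B i)" for i
    using assms(1) by (auto simp: cylinders_def)
  have "compactin (struct_topology L S) (B 0)"
    using det[of 0] compactin_determined by blast
  then have fip: "\<forall>\<U>. (\<forall>C\<in>\<U>. closedin (struct_topology L S) C) \<and>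
      (\<forall>\<F>. finite \<F> \<and> \<F> \<subseteq> \<U> \<longrightarrow> B 0 \<inter> \<Inter>\<F> \<noteq> {}) \<longrightarrow> B 0 \<inter> \<Inter>\<U> \<noteq> {}"
    unfolding compactin_fip by (rule conjunct2)
  have "B 0 \<inter> \<Inter>(range B) \<noteq> {}"
  proof (rule fip[rule_format], intro conjI ballI allI impI)
    show "closedin (struct_topology L S) C" if "C \<in> range B" for C
      using that det closedin_determined by blast
    fix \<F> assume "finite \<F> \<and> \<F> \<subseteq> range B"
    then have \<F>: "finite \<F>" "\<F> \<subseteq> range B" by auto
    then obtain I where I: "finite I" "\<F> = B ` I"
      by (auto dest: finite_subset_image)
    have "B (Max (insert 0 I)) \<subseteq> B i" if "i \<in> insert 0 I" for i
      using that I(1) by (intro decseqD[OF assms(2)] Max_ge) auto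
    then have "B (Max (insert 0 I)) \<subseteq> B 0 \<inter> \<Inter>\<F>" unfolding I(2) by blast
    then show "B 0 \<inter> \<Inter>\<F> \<noteq> {}" using nonempty by blast
  qed
  then show False using assms(3) by simp
qed

end

section \<open>The rate measure\<close>

context comb_levy_process
begin

abbreviation hit_prob :: "rels set \<Rightarrow> real \<Rightarrow> real" where
  "hit_prob B t \<equiv> measure (distr P (struct_borel L S) (X t)) B"

lemma hit_prob_eq:
  "0 \<le> t \<Longrightarrow> B \<in> sets (struct_borel L S) \<Longrightarrow> hit_prob B t = prob {\<omega> \<in> space P. X t \<omega> \<in> B}"
  by (simp add: measure_distr[OF random] vimage_def Int_def conj_commute)

lemma prob_space_distr_X: "0 \<le> t \<Longrightarrow> prob_space (distr P (struct_borel L S) (X t))"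
  by (intro prob_space_distr random)

text \<open>A cylinder of level \<open>n\<close> is a disjoint union of finitely many fibres, because there are only
  finitely many structures over the window, and none of these fibres lies over zero.\<close>

lemma cylinder_rate_exists:
  assumes "S \<subseteq> {1..}" "B \<in> cylinders L S"
  shows "\<exists>l. ((\<lambda>t. hit_prob B t / t) \<longlongrightarrow> l) (at_right 0)"
proof -
  obtain n where n: "1 \<le> n" "determined L S n B" and zero: "zero_struct L \<notin> B"
    using assms(2) by (auto simp: cylinders_def)
  note B = determined_subset[OF n(2)]
  have fibres: "B = (\<Union>A\<in>view L S n ` B. fibre L S n A)"
    using B determinedD[OF n(2)] by (fastforce simp: fibre_def)
  have images: "view L S n ` B \<subseteq> structs L (S \<inter> {1..n})"
    using B view_in_structs by blast
  then have fin: "finite (view L S n ` B)"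
    by (rule finite_subset) (simp add: finite_structs)
  have nonzero: "A \<noteq> zero_struct L" if "A \<in> view L S n ` B" for A
    using that determined_subset_visible[OF n(2) zero] by (auto simp: visible_def)
  have ex: "\<exists>l. ((\<lambda>t. prob {\<omega> \<in> space P. view L S n (X t \<omega>) = A} / t) \<longlongrightarrow> l) (at_right 0)"
    if "A \<in> view L S n ` B" for A
    using that images by (intro view_rate_exists[OF assms(1) _ nonzero]) auto
  define l where "l A = (SOME l. ((\<lambda>t. prob {\<omega> \<in> space P. view L S n (X t \<omega>) = A} / t) \<longlongrightarrow> l) (at_right 0))" for A
  have l: "((\<lambda>t. prob {\<omega> \<in> space P. view L S n (X t \<omega>) = A} / t) \<longlongrightarrow> l A) (at_right 0)"
    if "A \<in> view L S n ` B" for A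
    unfolding l_def using ex[OF that] by (rule someI_ex)
  have "((\<lambda>t. \<Sum>A\<in>view L S n ` B. prob {\<omega> \<in> space P. view L S n (X t \<omega>) = A} / t) \<longlongrightarrow> (\<Sum>A\<in>view L S n ` B. l A)) (at_right 0)"
    by (intro tendsto_sum l)
  moreover have "\<forall>\<^sub>F t in at_right 0. (\<Sum>A\<in>view L S n ` B. prob {\<omega> \<in> space P. view L S n (X t \<omega>) = A} / t) = hit_prob B t / t"
    using eventually_at_right_less[of 0]
  proof eventually_elim
    case (elim t)
    then interpret D: prob_space "distr P (struct_borel L S) (X t)"
      by (intro prob_space_distr_X) simp
    have sets: "fibre L S n A \<in> sets (struct_borel L S)" for A
      by (rule determined_in_sets[OF assms(1) determined_fibre])
    have "hit_prob B t = D.prob (\<Union>A\<in>view L S n ` B. fibre L S n A)"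
      using fibres by simp
    also have "\<dots> = (\<Sum>A\<in>view L S n ` B. hit_prob (fibre L S n A) t)"
      using sets by (intro D.finite_measure_finite_Union fin) (auto simp: disjoint_family_on_def fibre_def)
    also have "\<dots> = (\<Sum>A\<in>view L S n ` B. prob {\<omega> \<in> space P. view L S n (X t \<omega>) = A})"
    proof (rule sum.cong[OF refl])
      fix A
      have "{\<omega> \<in> space P. X t \<omega> \<in> fibre L S n A} = {\<omega> \<in> space P. view L S n (X t \<omega>) = A}"
        using value_in_structs[of t] elim by (auto simp: fibre_def)
      then show "hit_prob (fibre L S n A) t = prob {\<omega> \<in> space P. view L S n (X t \<omega>) = A}"
        using hit_prob_eq[OF _ sets, of t A] elim by simp
    qed
    finally show ?case by (simp add: sum_divide_distrib)
  qed
  ultimately show ?thesis by (intro exI) (rule Lim_transform_eventually)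
qed

definition rate :: "rels set \<Rightarrow> real" where
  "rate B = Lim (at_right 0) (\<lambda>t. hit_prob B t / t)"

lemma rate_tendsto:
  assumes "S \<subseteq> {1..}" "B \<in> cylinders L S"
  shows "((\<lambda>t. hit_prob B t / t) \<longlongrightarrow> rate B) (at_right 0)"
  using cylinder_rate_exists[OF assms] tendsto_Lim[OF trivial_limit_at_right_real]
  unfolding rate_def by blast

lemma rate_nonneg:
  assumes "S \<subseteq> {1..}" "B \<in> cylinders L S"
  shows "0 \<le> rate B"
proof (rule tendsto_lowerbound[OF rate_tendsto[OF assms]])
  show "\<forall>\<^sub>F t in at_right 0. 0 \<le> hit_prob B t / t"
    using eventually_at_right_less[of 0] by eventually_elim simp
qed simp

lemma rate_Un:
  assumes "S \<subseteq> {1..}" "A \<in> cylinders L S" "B \<in> cylinders L S" "A \<inter> B = {}"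
  shows "rate (A \<union> B) = rate A + rate B"
proof (rule tendsto_unique[OF trivial_limit_at_right_real])
  interpret ring_of_sets "structs L S" "cylinders L S" by (rule ring_of_sets_cylinders)
  show "((\<lambda>t. hit_prob (A \<union> B) t / t) \<longlongrightarrow> rate (A \<union> B)) (at_right 0)"
    using assms by (intro rate_tendsto) auto
  have "((\<lambda>t. hit_prob A t / t + hit_prob B t / t) \<longlongrightarrow> rate A + rate B) (at_right 0)"
    using assms by (intro tendsto_add rate_tendsto) auto
  moreover have "\<forall>\<^sub>F t in at_right 0. hit_prob A t / t + hit_prob B t / t = hit_prob (A \<union> B) t / t"
    using eventually_at_right_less[of 0]
  proof eventually_elim
    case (elim t)
    then interpret D: prob_space "distr P (struct_borel L S) (X t)"
      by (intro prob_space_distr_X) simp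
    have "hit_prob (A \<union> B) t = hit_prob A t + hit_prob B t"
      using assms cylinder_in_sets[OF assms(1)] by (intro D.finite_measure_Union) auto
    then show ?case by (simp add: add_divide_distrib)
  qed
  ultimately show "((\<lambda>t. hit_prob (A \<union> B) t / t) \<longlongrightarrow> rate A + rate B) (at_right 0)"
    by (rule Lim_transform_eventually)
qed

text \<open>The set \<open>{\<zero>}\<close> has no countable cover by cylinders, so Caratheodory's theorem leaves its mass
  uncontrolled. Restricting the extension to the nonzero structures
  by a density makes that mass zero and changes nothing on cylinders.\<close>

lemma rate_measure_exists:
  assumes S: "S \<subseteq> {1..}"
  shows "\<exists>\<mu>. sets \<mu> = sets (struct_borel L S) \<and> emeasure \<mu> {zero_struct L} = 0 \<and>
    (\<forall>B\<in>cylinders L S. emeasure \<mu> B = ennreal (rate B))"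
proof -
  interpret ring_of_sets "structs L S" "cylinders L S" by (rule ring_of_sets_cylinders)
  have rate_empty: "rate {} = 0"
    using rate_Un[OF S, of "{}" "{}"] by simp
  have "\<exists>\<nu> :: rels set \<Rightarrow> ennreal. (\<forall>B\<in>cylinders L S. \<nu> B = ennreal (rate B)) \<and>
      measure_space (structs L S) (sigma_sets (structs L S) (cylinders L S)) \<nu>"
  proof (rule caratheodory_empty_continuous)
    show "positive (cylinders L S) (\<lambda>B. ennreal (rate B))"
      by (simp add: positive_def rate_empty)
    show "additive (cylinders L S) (\<lambda>B. ennreal (rate B))"
      unfolding additive_def using rate_Un[OF S] rate_nonneg[OF S] by (simp add: ennreal_plus)
    fix B :: "nat \<Rightarrow> rels set"
    assume B: "range B \<subseteq> cylinders L S" "decseq B" "(\<Inter>i. B i) = {}"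
    then obtain i where "B i = {}" using decseq_cylinders_empty[OF S] by blast
    then have "B j = {}" if "i \<le> j" for j
      using decseqD[OF B(2) that] by simp
    then have "\<forall>\<^sub>F j in sequentially. ennreal (rate (B j)) = 0"
      by (intro eventually_sequentiallyI[of i]) (simp add: rate_empty)
    then show "(\<lambda>j. ennreal (rate (B j))) \<longlonglongrightarrow> 0" by (rule tendsto_eventually)
  qed simp
  then obtain \<nu> where \<nu>: "\<And>B. B \<in> cylinders L S \<Longrightarrow> \<nu> B = ennreal (rate B)"
    "measure_space (structs L S) (sigma_sets (structs L S) (cylinders L S)) \<nu>"
    by blast
  define N where "N = measure_of (structs L S) (cylinders L S) \<nu>"
  have cyl: "cylinders L S \<subseteq> Pow (structs L S)" using space_closed .
  have sets_N: "sets N = sets (struct_borel L S)"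
    using cyl by (simp add: N_def cylinders_generate[OF S])
  have "sets N = sigma_sets (structs L S) (cylinders L S)"
    using cyl by (simp add: N_def)
  then have N: "emeasure N B = ennreal (rate B)" if "B \<in> cylinders L S" for B
    using emeasure_measure_of[OF N_def cyl, of B] \<nu> that
    by (simp only: measure_space_def sigma_sets.Basic)
  define \<mu> where "\<mu> = density N (indicator (structs L S - {zero_struct L}))"
  have nonzero: "structs L S - {zero_struct L} \<in> sets N"
    using nonzero_in_sets[OF S] by (simp add: sets_N)
  have \<mu>: "emeasure \<mu> B = emeasure N ((structs L S - {zero_struct L}) \<inter> B)" if "B \<in> sets N" for B
    unfolding \<mu>_def using nonzero that by (rule emeasure_restricted)
  show ?thesis
  proof (intro exI[of _ \<mu>] conjI ballI)
    show "sets \<mu> = sets (struct_borel L S)" by (simp add: \<mu>_def sets_N)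
    have "structs L S - (structs L S - {zero_struct L}) \<in> sets N"
      using nonzero_in_sets[OF S] sets.compl_sets[of _ "struct_borel L S"] by (auto simp: sets_N)
    moreover have "structs L S - (structs L S - {zero_struct L}) = {zero_struct L}"
      using zero_in_structs by blast
    ultimately have "{zero_struct L} \<in> sets N" by (simp only:)
    then show "emeasure \<mu> {zero_struct L} = 0" by (simp add: \<mu>)
    fix B assume B: "B \<in> cylinders L S"
    then have "(structs L S - {zero_struct L}) \<inter> B = B"
      using cyl by (auto simp: cylinders_def)
    then show "emeasure \<mu> B = ennreal (rate B)"
      using N[OF B] \<mu>[of B] cylinder_in_sets[OF S B] by (simp add: sets_N)
  qed
qed

end

section \<open>Vague convergence\<close>

abbreviation punctured :: "nat list \<Rightarrow> nat set \<Rightarrow> rels set" where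
  "punctured L S \<equiv> structs L S - {zero_struct L}"

abbreviation punctured_topology :: "nat list \<Rightarrow> nat set \<Rightarrow> rels topology" where
  "punctured_topology L S \<equiv> subtopology (struct_topology L S) (punctured L S)"

lemma topspace_punctured: "topspace (punctured_topology L S) = punctured L S"
  by auto

context
  fixes L :: "nat list" and S :: "nat set"
  assumes S: "S \<subseteq> {1..}"
begin

lemma openin_punctured_iff:
  "openin (punctured_topology L S) U \<longleftrightarrow> openin (struct_topology L S) U \<and> U \<subseteq> punctured L S"
  by (rule openin_open_subtopology[OF openin_nonzero[OF S]])

text \<open>A cylinder is clopen and compact.\<close>

lemma test_function_cylinder_indicator:
  assumes "B \<in> cylinders L S"
  shows "continuous_map (punctured_topology L S) euclideanreal (indicator B)"
    and "compact_support (punctured_topology L S) (indicator B)"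
proof -
  obtain n where n: "determined L S n B" and zero: "zero_struct L \<notin> B"
    using assms by (auto simp: cylinders_def)
  have B: "B \<subseteq> punctured L S" using determined_subset[OF n] zero by auto
  have op: "openin (punctured_topology L S) B"
    using B openin_determined[OF S n] by (simp add: openin_punctured_iff)
  have "closedin (punctured_topology L S) (B \<inter> punctured L S)"
    using closedin_determined[OF S n] by (auto simp: closedin_subtopology)
  then have cl: "closedin (punctured_topology L S) B"
    using B by (simp add: Int_absorb2)
  show "continuous_map (punctured_topology L S) euclideanreal (indicator B)"
    unfolding continuous_map
  proof (intro conjI allI impI)
    fix V :: "real set"
    have "{M \<in> punctured L S. indicator B M \<in> V} =
        (if 1 \<in> V then B else {}) \<union> (if 0 \<in> V then punctured L S - B else {})"
      using B by (auto simp: indicator_def)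
    moreover have "openin (punctured_topology L S) (if 0 \<in> V then punctured L S - B else {})"
      using cl unfolding closedin_def topspace_punctured by simp
    moreover have "openin (punctured_topology L S) (if 1 \<in> V then B else {})"
      using op by simp
    ultimately show "openin (punctured_topology L S) {M \<in> topspace (punctured_topology L S). indicator B M \<in> V}"
      unfolding topspace_punctured by (simp only: openin_Un)
  qed auto
  have "{M \<in> topspace (punctured_topology L S). indicator B M \<noteq> (0 :: real)} = B"
    using B unfolding topspace_punctured by (auto simp: indicator_def)
  then show "compact_support (punctured_topology L S) (indicator B)"
    unfolding compact_support_def
    using closure_of_closedin[OF cl] compactin_determined[OF S n] B
    by (simp add: compactin_subtopology)
qed

text \<open>Around each point of the support there is a fibre that avoids zero and on which the function varies
  by less than \<open>\<epsilon>\<close>. Finitely many of these cover the compact support, and the largest of their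
  levels works for all points and also tells the support from zero. A point outside of the support is compared with its neighbours in the
  support, or both values are 0.\<close>

lemma test_function_uniform:
  assumes f: "continuous_map (punctured_topology L S) euclideanreal f"
    and supp: "compact_support (punctured_topology L S) f"
    and "0 < \<epsilon>"
  shows "\<exists>n\<ge>1. (\<forall>M\<in>punctured L S - visible L S n. f M = 0) \<and>
    (\<forall>M\<in>punctured L S. \<forall>M'\<in>punctured L S. view L S n M' = view L S n M \<longrightarrow> \<bar>f M - f M'\<bar> \<le> \<epsilon>)"
proof -
  let ?T = "punctured_topology L S"
  define K where "K = ?T closure_of {x \<in> topspace ?T. f x \<noteq> 0}"
  have K: "compactin (struct_topology L S) K" "K \<subseteq> punctured L S"
    using supp by (auto simp: compact_support_def K_def compactin_subtopology)
  have outside: "f M = 0" if "M \<in> punctured L S" "M \<notin> K" for M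
    using that closure_of_subset[of "{x \<in> topspace ?T. f x \<noteq> 0}" ?T]
    unfolding K_def topspace_punctured by blast
  have ex: "\<exists>n. fibre L S n (view L S n M) \<subseteq> {M' \<in> punctured L S. f M' \<in> ball (f M) (\<epsilon> / 2)}"
    if "M \<in> K" for M
  proof -
    have "openin ?T {M' \<in> topspace ?T. f M' \<in> ball (f M) (\<epsilon> / 2)}"
      using f by (rule openin_continuous_map_preimage) simp
    then have "openin (struct_topology L S) {M' \<in> punctured L S. f M' \<in> ball (f M) (\<epsilon> / 2)}"
      unfolding topspace_punctured openin_punctured_iff by (rule conjunct1)
    moreover have "M \<in> {M' \<in> punctured L S. f M' \<in> ball (f M) (\<epsilon> / 2)}"
      using that K(2) assms(3) by auto
    ultimately show ?thesis by (rule locally_determined[OF S]) (rule exI)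
  qed
  define level where
    "level M = (SOME n. fibre L S n (view L S n M) \<subseteq> {M' \<in> punctured L S. f M' \<in> ball (f M) (\<epsilon> / 2)})" for M
  have level: "fibre L S (level M) (view L S (level M) M) \<subseteq> {M' \<in> punctured L S. f M' \<in> ball (f M) (\<epsilon> / 2)}"
    if "M \<in> K" for M
    unfolding level_def using ex[OF that] by (rule someI_ex)
  let ?C = "\<lambda>M. fibre L S (level M) (view L S (level M) M)"
  have "K \<subseteq> \<Union> (?C ` K)" using K(2) by (auto simp: fibre_def)
  moreover have "\<forall>U\<in>?C ` K. openin (struct_topology L S) U"
    using openin_determined[OF S determined_fibre] by blast
  ultimately have "\<exists>\<F>. finite \<F> \<and> \<F> \<subseteq> ?C ` K \<and> K \<subseteq> \<Union>\<F>"
    by (intro K(1)[unfolded compactin_def, THEN conjunct2, THEN spec, THEN mp] conjI)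
  then obtain \<F> where \<F>: "finite \<F>" "\<F> \<subseteq> ?C ` K" "K \<subseteq> \<Union>\<F>" by (elim exE conjE)
  then obtain F where F: "finite F" "F \<subseteq> K" "\<F> = ?C ` F"
    by (meson finite_subset_image)
  define n where "n = Max (insert 1 (level ` F))"
  have n: "1 \<le> n" "\<And>M. M \<in> F \<Longrightarrow> level M \<le> n"
    using F(1) by (auto simp: n_def intro!: Max_ge)
  have near: "M' \<noteq> zero_struct L \<and> \<bar>f M - f M'\<bar> < \<epsilon>"
    if M: "M \<in> K" "M' \<in> structs L S" "view L S n M' = view L S n M" for M M'
  proof -
    obtain N where N: "N \<in> F" "M \<in> ?C N" using \<F>(3) M(1) unfolding F(3) by blast
    have "M \<in> structs L S" using M(1) K(2) by blast
    then have "view L S (level N) M' = view L S (level N) M"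
      using view_mono[OF n(2)[OF N(1)] M(2)] M(3) by blast
    then have "M' \<in> ?C N" using N(2) M(2) by (simp add: fibre_def)
    then have balls: "f M \<in> ball (f N) (\<epsilon> / 2)" "f M' \<in> ball (f N) (\<epsilon> / 2)" and "M' \<in> punctured L S"
      using level[of N] N F(2) by blast+
    have "\<bar>f M - f M'\<bar> < \<epsilon>"
      using balls unfolding mem_ball dist_real_def by linarith
    then show ?thesis using \<open>M' \<in> punctured L S\<close> by simp
  qed
  have "f M = 0" if "M \<in> punctured L S" "M \<notin> visible L S n" for M
  proof (rule outside[OF that(1)], rule notI)
    assume "M \<in> K"
    then show False
      using near[of M "zero_struct L"] that by (auto simp: visible_def)
  qed
  moreover have "\<bar>f M - f M'\<bar> \<le> \<epsilon>"
    if M: "M \<in> punctured L S" "M' \<in> punctured L S" "view L S n M' = view L S n M" for M M'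
  proof -
    consider "M \<in> K" | "M' \<in> K" | "M \<notin> K" "M' \<notin> K" by blast
    then show ?thesis
    proof cases
      case 1
      then show ?thesis using near[OF 1 _ M(3)] M(2) by simp
    next
      case 2
      then show ?thesis using near[OF 2, of M] M by auto
    next
      case 3
      then show ?thesis using outside[OF M(1)] outside[OF M(2)] assms(3) by simp
    qed
  qed
  ultimately show ?thesis using n(1) by blast
qed

lemma test_function_measurable:
  assumes f: "continuous_map (punctured_topology L S) euclideanreal f"
    and N: "sets N = sets (struct_borel L S)"
  shows "f \<in> borel_measurable (restrict_space N (punctured L S))"
proof (rule borel_measurableI)
  fix V :: "real set" assume "open V"
  have space: "space (restrict_space N (punctured L S)) = punctured L S"
    using sets_eq_imp_space_eq[OF N] by (auto simp: space_restrict_space)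
  have "openin (punctured_topology L S) {M \<in> topspace (punctured_topology L S). f M \<in> V}"
    using f open_openin[THEN iffD1, OF \<open>open V\<close>] by (rule openin_continuous_map_preimage)
  then have "openin (struct_topology L S) {M \<in> punctured L S. f M \<in> V}"
    unfolding topspace_punctured openin_punctured_iff by (rule conjunct1)
  then have "{M \<in> punctured L S. f M \<in> V} \<in> sets N"
    unfolding N by (rule open_in_sets_struct_borel)
  moreover have "f -` V \<inter> punctured L S = punctured L S \<inter> {M \<in> punctured L S. f M \<in> V}" by blast
  ultimately show "f -` V \<inter> space (restrict_space N (punctured L S)) \<in> sets (restrict_space N (punctured L S))"
    unfolding space sets_restrict_space by blast
qed

lemma measure_restrict_punctured:
  assumes "sets N = sets (struct_borel L S)" "B \<in> cylinders L S"
  shows "emeasure (restrict_space N (punctured L S)) B = emeasure N B"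
    and "measure (restrict_space N (punctured L S)) B = measure N B"
    and "B \<in> sets (restrict_space N (punctured L S))"
proof -
  have B: "B \<subseteq> punctured L S"
    using assms(2) by (auto simp: cylinders_def dest: determined_subset)
  have "punctured L S \<inter> space N \<in> sets N"
    using nonzero_in_sets[OF S] sets_eq_imp_space_eq[OF assms(1)] assms(1) by (simp add: Int_absorb2)
  from emeasure_restrict_space[OF this B] measure_restrict_space[OF this B]
  show "emeasure (restrict_space N (punctured L S)) B = emeasure N B"
    "measure (restrict_space N (punctured L S)) B = measure N B" .
  have "B \<in> sets N" using cylinder_in_sets[OF S assms(2)] assms(1) by simp
  then show "B \<in> sets (restrict_space N (punctured L S))"
    unfolding sets_restrict_space using B by (intro image_eqI[of _ _ B]) auto
qed

text \<open>The function is replaced by its value at the restriction of the argument, which again is a structure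
  over \<open>S\<close> and lies in the same fibre. The error is carried by the set \<open>visible L S m\<close>
  outside of which the function vanishes. It has a level of its own, so that \<open>m\<close> can be kept while
  \<open>n\<close> grows with the precision. The mass at level \<open>n\<close> could grow as \<open>\<epsilon>\<close> shrinks.\<close>

lemma integral_test_function_approx:
  assumes f: "continuous_map (punctured_topology L S) euclideanreal f"
    and N: "sets N = sets (struct_borel L S)"
    and fin_N: "\<And>B. B \<in> cylinders L S \<Longrightarrow> emeasure N B < \<infinity>"
    and n: "1 \<le> m" "m \<le> n"
    and outside: "\<And>M. M \<in> punctured L S \<Longrightarrow> M \<notin> visible L S m \<Longrightarrow> f M = 0"
    and osc: "\<And>M M'. M \<in> punctured L S \<Longrightarrow> M' \<in> punctured L S \<Longrightarrow> view L S n M' = view L S n M \<Longrightarrow> \<bar>f M - f M'\<bar> \<le> \<epsilon>"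
  shows "\<bar>integral\<^sup>L (restrict_space N (punctured L S)) f -
      (\<Sum>A\<in>structs L (S \<inter> {1..n}) - {zero_struct L}. f A * measure N (fibre L S n A))\<bar>
    \<le> \<epsilon> * measure N (visible L S m)"
proof -
  let ?N = "restrict_space N (punctured L S)"
  let ?A = "structs L (S \<inter> {1..n}) - {zero_struct L}"
  let ?V = "visible L S m"
  define g where "g M = (\<Sum>A\<in>?A. f A * indicator (fibre L S n A) M)" for M
  have fin: "finite ?A" by (simp add: finite_structs)
  note V = measure_restrict_punctured[OF N visible_in_cylinders[OF n(1)]]
  have "1 \<le> n" using n by simp
  note cyl = fibre_in_cylinders[OF \<open>1 \<le> n\<close>]
  note C = measure_restrict_punctured[OF N cyl]
  have space: "space ?N = punctured L S"
    using sets_eq_imp_space_eq[OF N] by (auto simp: space_restrict_space)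
  have C_le: "emeasure ?N (fibre L S n A) < \<infinity>" if "A \<in> ?A" for A
    using that fin_N[OF cyl[of A]] C(1)[of A] by simp
  have g_int: "integrable ?N g"
    unfolding g_def
    by (intro Bochner_Integration.integrable_sum integrable_mult_right integrable_real_indicator C(3) C_le) auto
  have g_eq: "integral\<^sup>L ?N g = (\<Sum>A\<in>?A. f A * measure N (fibre L S n A))"
  proof -
    have "integral\<^sup>L ?N g = (\<Sum>A\<in>?A. \<integral>M. f A * indicator (fibre L S n A) M \<partial>?N)"
      unfolding g_def
      by (intro Bochner_Integration.integral_sum integrable_mult_right integrable_real_indicator C(3) C_le) auto
    also have "\<dots> = (\<Sum>A\<in>?A. f A * measure N (fibre L S n A))"
    proof (rule sum.cong[OF refl])
      fix A assume A: "A \<in> ?A"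
      then have "fibre L S n A \<inter> space ?N = fibre L S n A"
        using sets.sets_into_space[OF C(3)[of A]] by auto
      then show "(\<integral>M. f A * indicator (fibre L S n A) M \<partial>?N) = f A * measure N (fibre L S n A)"
        using A C(2)[of A] by simp
    qed
    finally show ?thesis .
  qed
  have close: "\<bar>f M - g M\<bar> \<le> \<epsilon> * indicator ?V M" if "M \<in> space ?N" for M
  proof (cases "M \<in> visible L S n")
    case True
    then have M: "M \<in> structs L S" "view L S n M \<noteq> zero_struct L" by (auto simp: visible_def)
    have A: "view L S n M \<in> ?A" using view_in_structs[OF M(1)] M(2) by simp
    have "structs L (S \<inter> {1..n}) \<subseteq> structs L S" by (rule structs_mono) simp
    then have view: "view L S n M \<in> punctured L S" using A by blast
    have idem: "view L S n (view L S n M) = view L S n M"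
      using A restr_id[of "view L S n M" L "S \<inter> {1..n}"] by (simp only: view_def DiffD1)
    have "\<bar>f M - f (view L S n M)\<bar> \<le> \<epsilon>"
      using that idem unfolding space by (intro osc view)
    moreover have "f M = 0 \<and> f (view L S n M) = 0" if "M \<notin> ?V"
    proof -
      have "view L S m (view L S n M) = view L S m M"
        using view M(1) by (intro view_mono[OF n(2) _ _ idem]) auto
      then have "view L S n M \<notin> ?V" using that M(1) by (simp add: visible_def)
      then show ?thesis using outside view that \<open>M \<in> space ?N\<close> space by simp
    qed
    moreover have "g M = f (view L S n M)"
    proof -
      have "g M = (\<Sum>A\<in>?A. if A = view L S n M then f A else 0)"
        unfolding g_def using M(1) by (intro sum.cong) (auto simp: fibre_def)
      then show ?thesis using fin A by simp
    qed
    ultimately show ?thesis by (cases "M \<in> ?V") simp_all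
  next
    case False
    then have "M \<in> punctured L S" using that space by simp
    then have "view L S n M = zero_struct L" using False by (auto simp: visible_def)
    then have "g M = 0" unfolding g_def by (intro sum.neutral) (auto simp: fibre_def)
    moreover have "M \<notin> ?V" using False visible_mono[OF n(2)] by blast
    ultimately show ?thesis using outside[OF \<open>M \<in> punctured L S\<close>] by simp
  qed
  have bound_int: "integrable ?N (\<lambda>M. \<epsilon> * indicator ?V M)"
    using fin_N[OF visible_in_cylinders[OF n(1)]] V by (intro integrable_mult_right integrable_real_indicator) auto
  have [measurable]: "f \<in> borel_measurable ?N" "g \<in> borel_measurable ?N"
    using test_function_measurable[OF f N] g_int by auto
  have diff_int: "integrable ?N (\<lambda>M. f M - g M)"
  proof (rule Bochner_Integration.integrable_bound[OF bound_int])
    show "AE M in ?N. norm (f M - g M) \<le> norm (\<epsilon> * indicator ?V M)"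
      using close by (intro AE_I2) (fastforce intro: order_trans[OF _ abs_ge_self])
  qed measurable
  have "integrable ?N f"
    using Bochner_Integration.integrable_add[OF diff_int g_int] by simp
  then have "integral\<^sup>L ?N f - integral\<^sup>L ?N g = (\<integral>M. f M - g M \<partial>?N)"
    using g_int by simp
  also have "\<bar>\<dots>\<bar> \<le> (\<integral>M. \<bar>f M - g M\<bar> \<partial>?N)" by (rule integral_abs_bound)
  also have "\<dots> \<le> (\<integral>M. \<epsilon> * indicator ?V M \<partial>?N)"
    using close diff_int bound_int by (intro integral_mono) auto
  also have "\<dots> = \<epsilon> * measure N ?V"
    using sets.sets_into_space[OF V(3)] V(2) by (simp add: Int_absorb2)
  finally show ?thesis unfolding g_eq .
qed

text \<open>The approximating sums involve finitely many fibres, on which the measures converge, and both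
  approximation errors are at most \<open>\<epsilon>\<close> times a bound for the mass of one fixed cylinder.\<close>

lemma vague_convergence_from_cylinders:
  assumes N: "\<And>t. sets (N t) = sets (struct_borel L S)" and \<mu>: "sets \<mu> = sets (struct_borel L S)"
    and fin_N: "\<forall>\<^sub>F t in F. \<forall>B\<in>cylinders L S. emeasure (N t) B < \<infinity>"
    and fin_\<mu>: "\<And>B. B \<in> cylinders L S \<Longrightarrow> emeasure \<mu> B < \<infinity>"
    and lim: "\<And>B. B \<in> cylinders L S \<Longrightarrow> ((\<lambda>t. measure (N t) B) \<longlongrightarrow> measure \<mu> B) F"
  shows "vague_convergence (punctured_topology L S) (\<lambda>t. restrict_space (N t) (punctured L S))
    (restrict_space \<mu> (punctured L S)) F"
  unfolding vague_convergence_def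
proof (intro allI impI tendstoI)
  fix f :: "rels \<Rightarrow> real" and \<delta> :: real
  assume f: "continuous_map (punctured_topology L S) euclideanreal f \<and> compact_support (punctured_topology L S) f"
    and "0 < \<delta>"
  obtain m where m: "1 \<le> m" and outside: "\<And>M. M \<in> punctured L S \<Longrightarrow> M \<notin> visible L S m \<Longrightarrow> f M = 0"
    using test_function_uniform[OF conjunct1[OF f] conjunct2[OF f] zero_less_one] by blast
  define c where "c = measure \<mu> (visible L S m) + 1"
  have c: "0 < c" by (simp add: c_def add_nonneg_pos)
  \<comment> \<open>Two errors of at most \<open>\<epsilon> c = \<delta> / 4\<close> and a difference of sums below \<open>\<delta> / 4\<close> stay below \<open>\<delta>\<close>.\<close>
  define \<epsilon> where "\<epsilon> = \<delta> / (4 * c)"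
  have \<epsilon>: "0 < \<epsilon>" "\<epsilon> * c = \<delta> / 4" using \<open>0 < \<delta>\<close> c by (auto simp: \<epsilon>_def)
  obtain k where osc_k: "\<And>M M'. M \<in> punctured L S \<Longrightarrow> M' \<in> punctured L S \<Longrightarrow>
      view L S k M' = view L S k M \<Longrightarrow> \<bar>f M - f M'\<bar> \<le> \<epsilon>"
    using test_function_uniform[OF conjunct1[OF f] conjunct2[OF f] \<epsilon>(1)] by blast
  define n where "n = max k m"
  have n: "m \<le> n" "k \<le> n" by (auto simp: n_def)
  have osc: "\<bar>f M - f M'\<bar> \<le> \<epsilon>" if "M \<in> punctured L S" "M' \<in> punctured L S" "view L S n M' = view L S n M" for M M'
    using that by (intro osc_k view_mono[OF n(2), of M' L S M]) auto
  let ?A = "structs L (S \<inter> {1..n}) - {zero_struct L}"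
  let ?s = "\<lambda>N. \<Sum>A\<in>?A. f A * measure N (fibre L S n A)"
  let ?I = "\<lambda>N. integral\<^sup>L (restrict_space N (punctured L S)) f"
  have "1 \<le> n" using m n by simp
  have approx: "\<bar>?I M - ?s M\<bar> \<le> \<epsilon> * measure M (visible L S m)"
    if "sets M = sets (struct_borel L S)" "\<And>B. B \<in> cylinders L S \<Longrightarrow> emeasure M B < \<infinity>" for M
    by (rule integral_test_function_approx[OF conjunct1[OF f] that m n(1) outside osc])
  have "((\<lambda>t. ?s (N t)) \<longlongrightarrow> ?s \<mu>) F"
    by (intro tendsto_sum tendsto_mult tendsto_const lim fibre_in_cylinders \<open>1 \<le> n\<close>) simp
  then have sums: "\<forall>\<^sub>F t in F. dist (?s (N t)) (?s \<mu>) < \<delta> / 4"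
    using \<open>0 < \<delta>\<close> by (intro tendstoD) auto
  have mass: "\<forall>\<^sub>F t in F. measure (N t) (visible L S m) < c"
    by (rule order_tendstoD(2)[OF lim[OF visible_in_cylinders[OF m]]]) (simp add: c_def)
  show "\<forall>\<^sub>F t in F. dist (integral\<^sup>L (restrict_space (N t) (punctured L S)) f)
      (integral\<^sup>L (restrict_space \<mu> (punctured L S)) f) < \<delta>"
    using sums mass fin_N
  proof eventually_elim
    case (elim t)
    have "\<bar>?I (N t) - ?s (N t)\<bar> \<le> \<epsilon> * measure (N t) (visible L S m)"
      using elim(3) by (intro approx N) auto
    also have "\<dots> \<le> \<epsilon> * c" using elim(2) \<epsilon>(1) by (intro mult_left_mono) auto
    finally have 1: "\<bar>?I (N t) - ?s (N t)\<bar> \<le> \<delta> / 4" using \<epsilon>(2) by simp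
    have "\<bar>?I \<mu> - ?s \<mu>\<bar> \<le> \<epsilon> * measure \<mu> (visible L S m)"
      by (intro approx \<mu> fin_\<mu>)
    also have "\<dots> \<le> \<epsilon> * c" using \<epsilon>(1) by (intro mult_left_mono) (auto simp: c_def)
    finally have 2: "\<bar>?I \<mu> - ?s \<mu>\<bar> \<le> \<delta> / 4" using \<epsilon>(2) by simp
    have "\<bar>?I (N t) - ?I \<mu>\<bar> < \<delta>"
      using 1 2 elim(1) \<open>0 < \<delta>\<close> unfolding dist_real_def by linarith
    then show ?case by (simp only: dist_real_def)
  qed
qed

end

section \<open>Existence and uniqueness\<close>

lemma scaled_distr_measure:
  assumes "prob_space D" "0 < t"
  shows "measure (scale_measure (ennreal (1 / t)) D) B = measure D B / t"
    and "emeasure (scale_measure (ennreal (1 / t)) D) B < \<infinity>"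
proof -
  interpret prob_space D by fact
  show "emeasure (scale_measure (ennreal (1 / t)) D) B < \<infinity>"
    by (simp add: ennreal_mult_less_top emeasure_eq_measure)
  show "measure (scale_measure (ennreal (1 / t)) D) B = measure D B / t"
    using assms(2) by (simp add: measure_def enn2real_mult)
qed

definition jump_rate_measure :: "'w measure \<Rightarrow> nat list \<Rightarrow> nat set \<Rightarrow> (real \<Rightarrow> 'w \<Rightarrow> rels) \<Rightarrow> rels measure \<Rightarrow> bool" where
  "jump_rate_measure P L S X \<mu> \<longleftrightarrow> sets \<mu> = sets (struct_borel L S) \<and>
    emeasure \<mu> {zero_struct L} = 0 \<and>
    (\<forall>n\<ge>1. emeasure \<mu> (visible L S n) < \<infinity>) \<and>
    vague_convergence (punctured_topology L S)
      (\<lambda>t. restrict_space (scale_measure (ennreal (1 / t)) (distr P (struct_borel L S) (X t))) (punctured L S))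
      (restrict_space \<mu> (punctured L S)) (at_right 0)"

context comb_levy_process
begin

lemma jump_rate_measure_exists:
  assumes S: "S \<subseteq> {1..}"
  shows "\<exists>\<mu>. jump_rate_measure P L S X \<mu>"
proof -
  obtain \<mu> where \<mu>: "sets \<mu> = sets (struct_borel L S)" "emeasure \<mu> {zero_struct L} = 0"
    "\<And>B. B \<in> cylinders L S \<Longrightarrow> emeasure \<mu> B = ennreal (rate B)"
    using rate_measure_exists[OF S] by blast
  have "vague_convergence (punctured_topology L S)
      (\<lambda>t. restrict_space (scale_measure (ennreal (1 / t)) (distr P (struct_borel L S) (X t))) (punctured L S))
      (restrict_space \<mu> (punctured L S)) (at_right 0)"
  proof (rule vague_convergence_from_cylinders[OF S _ \<mu>(1)])
    show "\<forall>\<^sub>F t in at_right 0. \<forall>B\<in>cylinders L S.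
        emeasure (scale_measure (ennreal (1 / t)) (distr P (struct_borel L S) (X t))) B < \<infinity>"
      using eventually_at_right_less[of 0]
      by eventually_elim (intro ballI scaled_distr_measure(2) prob_space_distr_X less_imp_le)
    show "emeasure \<mu> B < \<infinity>" if "B \<in> cylinders L S" for B
      using \<mu>(3)[OF that] by simp
    fix B assume B: "B \<in> cylinders L S"
    have "\<forall>\<^sub>F t in at_right 0. hit_prob B t / t =
        measure (scale_measure (ennreal (1 / t)) (distr P (struct_borel L S) (X t))) B"
      using eventually_at_right_less[of 0]
      by eventually_elim (intro scaled_distr_measure(1)[symmetric] prob_space_distr_X less_imp_le)
    with rate_tendsto[OF S B]
    have "((\<lambda>t. measure (scale_measure (ennreal (1 / t)) (distr P (struct_borel L S) (X t))) B) \<longlongrightarrow> rate B) (at_right 0)"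
      by (rule Lim_transform_eventually)
    moreover have "measure \<mu> B = rate B"
      using \<mu>(3)[OF B] rate_nonneg[OF S B] by (simp add: measure_def)
    ultimately show "((\<lambda>t. measure (scale_measure (ennreal (1 / t)) (distr P (struct_borel L S) (X t))) B) \<longlongrightarrow> measure \<mu> B) (at_right 0)"
      by simp
  qed simp
  moreover have "emeasure \<mu> (visible L S n) < \<infinity>" if "1 \<le> n" for n
    using \<mu>(3)[OF visible_in_cylinders[OF that]] by simp
  ultimately show ?thesis using \<mu>(1,2) unfolding jump_rate_measure_def by blast
qed

end

lemma jump_rate_measure_finite:
  assumes "jump_rate_measure P L S X \<mu>" "B \<in> cylinders L S" and S: "S \<subseteq> {1..}"
  shows "emeasure \<mu> B < \<infinity>"
proof -
  obtain n where "1 \<le> n" "determined L S n B" "zero_struct L \<notin> B"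
    using assms(2) by (auto simp: cylinders_def)
  then have "B \<subseteq> visible L S n" by (intro determined_subset_visible)
  moreover have "visible L S n \<in> sets \<mu>"
    using assms(1) cylinder_in_sets[OF S visible_in_cylinders[OF \<open>1 \<le> n\<close>]] by (simp add: jump_rate_measure_def)
  ultimately have "emeasure \<mu> B \<le> emeasure \<mu> (visible L S n)" by (rule emeasure_mono)
  also have "\<dots> < \<infinity>" using assms(1) \<open>1 \<le> n\<close> by (simp add: jump_rate_measure_def)
  finally show ?thesis .
qed

text \<open>Both measures are the limit of the same integrals of the indicator of a cylinder. The cylinders
  together with \<open>{\<zero>}\<close> are stable under intersection, generate the sigma-field and
  contain a countable cover by sets of finite measure.\<close>

lemma jump_rate_measure_unique:
  assumes S: "S \<subseteq> {1..}" and \<mu>: "jump_rate_measure P L S X \<mu>" and \<nu>: "jump_rate_measure P L S X \<nu>"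
  shows "\<mu> = \<nu>"
proof (rule measure_eqI_generator_eq_countable)
  interpret ring: ring_of_sets "structs L S" "cylinders L S" by (rule ring_of_sets_cylinders)
  let ?E = "insert {zero_struct L} (cylinders L S)"
  let ?A = "insert {zero_struct L} (visible L S ` {1..})"
  have disjoint: "{zero_struct L} \<inter> B = {}" "B \<inter> {zero_struct L} = {}" if "B \<in> cylinders L S" for B
    using that by (auto simp: cylinders_def)
  show "Int_stable ?E"
    unfolding Int_stable_def using disjoint by auto
  show E: "?E \<subseteq> Pow (structs L S)"
    using ring.space_closed by auto
  have sets: "sets (struct_borel L S) = sigma_sets (structs L S) ?E"
    unfolding cylinders_generate[OF S]
  proof (rule sigma_sets_eqI)
    fix B assume "B \<in> ?E"
    moreover have "{zero_struct L} = structs L S - (structs L S - {zero_struct L})"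
      using zero_in_structs by blast
    moreover have "structs L S - (structs L S - {zero_struct L}) \<in> sigma_sets (structs L S) (cylinders L S)"
      using nonzero_in_sets[OF S] unfolding cylinders_generate[OF S] by (rule sigma_sets.Compl)
    ultimately show "B \<in> sigma_sets (structs L S) (cylinders L S)"
      by (auto intro: sigma_sets.Basic)
  qed (auto intro: sigma_sets.Basic)
  then show "sets \<mu> = sigma_sets (structs L S) ?E" "sets \<nu> = sigma_sets (structs L S) ?E"
    using \<mu> \<nu> by (simp_all add: jump_rate_measure_def)
  show "?A \<subseteq> ?E" using visible_in_cylinders by auto
  have "\<Union>?A = {zero_struct L} \<union> (\<Union>n\<in>{1..}. visible L S n)" by auto
  also have "\<dots> = structs L S" unfolding Union_visible[OF S] using zero_in_structs by blast
  finally show "\<Union>?A = structs L S" .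
  show "countable ?A" by auto
  show "emeasure \<mu> B \<noteq> \<infinity>" if "B \<in> ?A" for B
    using that \<mu> unfolding jump_rate_measure_def by (auto simp: less_top)
  fix B assume "B \<in> ?E"
  then consider "B = {zero_struct L}" | "B \<in> cylinders L S" by blast
  then show "emeasure \<mu> B = emeasure \<nu> B"
  proof cases
    case 1
    then show ?thesis using \<mu> \<nu> by (simp add: jump_rate_measure_def)
  next
    case 2
    have fin: "emeasure \<rho> B < \<infinity>" if "jump_rate_measure P L S X \<rho>" for \<rho>
      using that 2 S by (rule jump_rate_measure_finite)
    let ?J = "\<lambda>t. integral\<^sup>L (restrict_space (scale_measure (ennreal (1 / t))
      (distr P (struct_borel L S) (X t))) (punctured L S)) (indicat_real B)"
    have lim: "(?J \<longlongrightarrow> measure \<rho> B) (at_right 0)" if \<rho>: "jump_rate_measure P L S X \<rho>" for \<rho>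
    proof -
      have sets: "sets \<rho> = sets (struct_borel L S)" using \<rho> by (simp add: jump_rate_measure_def)
      have "vague_convergence (punctured_topology L S)
          (\<lambda>t. restrict_space (scale_measure (ennreal (1 / t)) (distr P (struct_borel L S) (X t))) (punctured L S))
          (restrict_space \<rho> (punctured L S)) (at_right 0)"
        using \<rho> unfolding jump_rate_measure_def by (elim conjE)
      then have "(?J \<longlongrightarrow> integral\<^sup>L (restrict_space \<rho> (punctured L S)) (indicat_real B)) (at_right 0)"
        using test_function_cylinder_indicator[OF S 2]
        unfolding vague_convergence_def by (elim allE[of _ "indicator B"] impE) (rule conjI)
      also have "integral\<^sup>L (restrict_space \<rho> (punctured L S)) (indicat_real B) = measure \<rho> B"
        using sets.sets_into_space[OF measure_restrict_punctured(3)[OF S sets 2]]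
          measure_restrict_punctured(2)[OF S sets 2]
        by (simp add: Int_absorb2)
      finally show ?thesis .
    qed
    have "measure \<mu> B = measure \<nu> B"
      by (rule tendsto_unique[OF trivial_limit_at_right_real lim[OF \<mu>] lim[OF \<nu>]])
    then show ?thesis
      using fin[OF \<mu>] fin[OF \<nu>] by (simp add: emeasure_eq_ennreal_measure less_top)
  qed
qed

theorem theorem4p6:
  fixes P :: "'w measure" and L :: "nat list" and S :: "nat set" and X :: "real \<Rightarrow> 'w \<Rightarrow> rels"
  assumes "sorted L" and "L \<noteq> []" and "last L \<ge> 1"
    and "S \<subseteq> {1..}"
    and "comb_levy_process P L S X"
  shows "\<exists>!\<mu>. sets \<mu> = sets (struct_borel L S) \<and>
    emeasure \<mu> {zero_struct L} = 0 \<and>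
    (\<forall>n\<ge>1. emeasure \<mu> {M \<in> structs L S. restr L (S \<inter> {1..n}) M \<noteq> zero_struct L} < \<infinity>) \<and>
    vague_convergence (subtopology (struct_topology L S) (structs L S - {zero_struct L}))
      (\<lambda>t. restrict_space (scale_measure (ennreal (1 / t)) (distr P (struct_borel L S) (X t)))
             (structs L S - {zero_struct L}))
      (restrict_space \<mu> (structs L S - {zero_struct L}))
      (at_right 0)"
proof -
  obtain \<mu> where \<mu>: "jump_rate_measure P L S X \<mu>"
    using comb_levy_process.jump_rate_measure_exists[OF assms(5,4)] by blast
  then have "\<exists>!\<mu>. jump_rate_measure P L S X \<mu>"
    using jump_rate_measure_unique[OF assms(4)] by (intro ex1I)
  then show ?thesis
    unfolding jump_rate_measure_def visible_def view_def .
qed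

end
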